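(* Let $\bar x\in\Gamma$ be a stationary point of (P), let MSCQ hold at $\bar x$ with modulus $\sigma>0$, and let $\bar x$ be a tilt-stable local minimizer of (P) with modulus $\kappa>0$. Suppose there is $\bar u\in K_\Gamma(\bar x,-\nabla f(\bar x))$ with $\nabla g(\bar x)\bar u\ne0$, and let $\bar\lambda$ be the multiplier defined below. Then for every $u\in\mathcal S$ with $\langle\bar\lambda,\nabla g(\bar x)u\rangle=0$ and $\bar\lambda_0\big(\|\nabla g_r(\bar x)u\|^2-(\nabla g_0(\bar x)u)^2\big)=0$, $$\langle(\nabla^2 f(\bar x)+\nabla^2\langle\bar\lambda,g\rangle(\bar x))u,u\rangle\ge\frac1\kappa.$$ Moreover, $$\mathrm{tilt}(f+\delta_\Gamma,\bar x)\ge\sup\Big\{\frac{1}{\langle(\nabla^2 f(\bar x)+\nabla^2\langle\bar\lambda,g\rangle(\bar x))u,u\rangle}\;\Big|\;u\in\mathcal S,\ \langle\bar\lambda,\nabla g(\bar x)u\rangle=0,\ \bar\lambda_0\big(\|\nabla g_r(\bar x)u\|^2-(\nabla g_0(\bar x)u)^2\big)=0\Big\}.$$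
   Context: Setting. Let $n,m\ge1$ and let $\mathcal Q:=\{(q_0,q_r)\in\mathbb R\times\mathbb R^m:\|q_r\|\le q_0\}$ be the second-order cone. For $q=(q_0,q_r)\in\mathbb R^{1+m}$ write $\hat q:=(-q_0,q_r)$, and let $\mathcal Q^*:=\{\hat q: q\in\mathcal Q\}=\{(q_0,q_r):\|q_r\|\le-q_0\}$. Problem (P) is: minimize $f(x)$ subject to $x\in\Gamma:=\{x\in\mathbb R^n: g(x)\in\mathcal Q\}$, where $f:\mathbb R^n\to\mathbb R$ and $g=(g_0,g_r):\mathbb R^n\to\mathbb R\times\mathbb R^m$ are $C^2$-smooth around a point $\bar x\in\Gamma$ with $g(\bar x)=0$. $\hat g(x):=(-g_0(x),g_r(x))$. $\nabla g(x)$ is the Jacobian, $\nabla g(x)^*$ its transpose, and $\nabla^2\langle\lambda,g\rangle(x)=\sum_i\lambda_i\nabla^2 g_i(x)$. $\mathcal S$ is the unit sphere. Special multiplier: $\bar\lambda:=\dfrac{\|\nabla f(\bar x)\|}{\|\nabla g(\bar x)^*\nabla\hat g(\bar x)\bar u\|}\,\nabla\hat g(\bar x)\bar u$ (with $\bar\lambda:=0$ when $\nabla f(\bar x)=0$). MSCQ. The metric subregularity constraint qualification (MSCQ) holds at $\bar x$ with modulus $\sigma>0$ if there is a neighborhood $U$ of $\bar x$ with $\operatorname{dist}(x;\Gamma)\le\sigma\operatorname{dist}(g(x);\mathcal Q)$ for all $x\in U$. Cones. $T_\Gamma(x)$ is the Bouligand tangent cone $\{v:\exists t_k\downarrow0,\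 v_k\to v,\ x+t_kv_k\in\Gamma\}$; the critical cone is $K_\Gamma(x,x^* ):=\{u\in T_\Gamma(x):\langle x^*,u\rangle=0\}$. Stationarity and tilt stability. $\bar x$ is a stationary point of (P) if $-\nabla f(\bar x)\in N_\Gamma(\bar x)$, where $N_\Gamma$ is the limiting (Mordukhovich) normal cone. Let $\varphi:=f+\delta_\Gamma$ ($\delta_\Gamma$ the indicator function of $\Gamma$). $\bar x$ is a tilt-stable local minimizer of (P) with modulus $\kappa>0$ if there is $\gamma>0$ such that $M_\gamma(v^* ):=\operatorname{argmin}\{\varphi(x)-\langle v^*,x\rangle:\|x-\bar x\|\le\gamma\}$ is single-valued and Lipschitz continuous with constant $\kappa$ on a neighborhood of $0$, with $M_\gamma(0)=\{\bar x\}$. The exact bound of tilt stability is $\mathrm{tilt}(\varphi,\bar x):=\inf_{\gamma>0}\operatorname{lip}M_\gamma(0)$, where $\operatorname{lip}M_\gamma(0)$ is the infimum of the Lipschitz constants of $M_\gamma$ on neighborhoods of $0$.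
   Formalization: The exact bound tilt(φ, x̄) is taken as the infimum of lip M_γ(0) only over those γ>0 with M_γ(0)={x̄}; over all γ>0 the second inequality fails, since for large γ M_γ may follow a different, sharper minimizer. *)

theory Defs
  imports "HOL-Analysis.Analysis"
begin

definition SOC :: "(real \<times> (real^'m)) set" where
  "SOC = {(q0, qr). norm qr \<le> q0}"

definition C2_on :: "(real^'n \<Rightarrow> real) \<Rightarrow> (real^'n \<Rightarrow> real^'n) \<Rightarrow> (real^'n \<Rightarrow> real^'n^'n)
    \<Rightarrow> (real^'n) set \<Rightarrow> bool" where
  "C2_on f Df Hf U \<longleftrightarrow> open U \<and>
     (\<forall>x\<in>U. (f has_derivative (\<lambda>h. Df x \<bullet> h)) (at x) \<and>
             (Df has_derivative (\<lambda>h. Hf x *v h)) (at x)) \<and>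
     continuous_on U Hf"

definition regular_normal_cone :: "('a::euclidean_space) set \<Rightarrow> 'a \<Rightarrow> 'a set" where
  "regular_normal_cone C x = {v. \<forall>e>0. \<exists>d>0. \<forall>y\<in>C. norm (y - x) < d \<longrightarrow> v \<bullet> (y - x) \<le> e * norm (y - x)}"

definition limiting_normal_cone :: "('a::euclidean_space) set \<Rightarrow> 'a \<Rightarrow> 'a set" where
  "limiting_normal_cone C x = (if x \<in> C then
     {v. \<exists>xk vk. (\<forall>k. xk k \<in> C \<and> vk k \<in> regular_normal_cone C (xk k)) \<and>
                 xk \<longlonglongrightarrow> x \<and> vk \<longlonglongrightarrow> v} else {})"

definition tangent_cone :: "('a::real_normed_vector) set \<Rightarrow> 'a \<Rightarrow> 'a set" where
  "tangent_cone C x = {v. \<exists>t vk. (\<forall>k. t k > 0 \<and> x + t k *\<^sub>R vk k \<in> C) \<and>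
                           t \<longlonglongrightarrow> 0 \<and> vk \<longlonglongrightarrow> v}"

definition critical_cone :: "('a::real_inner) set \<Rightarrow> 'a \<Rightarrow> 'a \<Rightarrow> 'a set" where
  "critical_cone C x xs = {u \<in> tangent_cone C x. xs \<bullet> u = 0}"

text \<open>Argmin map M_gamma(v) of phi - <v,.> over the closed ball, where phi = f + indicator of C.\<close>
definition tilt_argmin :: "('a::real_inner \<Rightarrow> real) \<Rightarrow> 'a set \<Rightarrow> 'a \<Rightarrow> real \<Rightarrow> 'a \<Rightarrow> 'a set" where
  "tilt_argmin f C xb \<gamma> v = {x \<in> C \<inter> cball xb \<gamma>.
      \<forall>y \<in> C \<inter> cball xb \<gamma>. f x - v \<bullet> x \<le> f y - v \<bullet> y}"

definition tilt_stable :: "('a::real_inner \<Rightarrow> real) \<Rightarrow> 'a set \<Rightarrow> 'a \<Rightarrow> real \<Rightarrow> bool" where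
  "tilt_stable f C xb \<kappa> \<longleftrightarrow> (\<exists>\<gamma>>0. tilt_argmin f C xb \<gamma> 0 = {xb} \<and>
     (\<exists>V. open V \<and> 0 \<in> V \<and> (\<forall>v\<in>V. \<exists>x. tilt_argmin f C xb \<gamma> v = {x}) \<and>
        (\<forall>v\<in>V. \<forall>w\<in>V. \<forall>x\<in>tilt_argmin f C xb \<gamma> v. \<forall>y\<in>tilt_argmin f C xb \<gamma> w.
            dist x y \<le> \<kappa> * dist v w)))"

text \<open>lip M(0): infimum of Lipschitz constants of the (single-valued near 0) map M
  on neighbourhoods of 0; equals +infinity if there is none.\<close>
definition lip_at0 :: "('a::real_normed_vector \<Rightarrow> 'b::metric_space set) \<Rightarrow> ereal" where
  "lip_at0 M = Inf {ereal L | L. L \<ge> 0 \<and> (\<exists>d>0.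
      (\<forall>v\<in>ball 0 d. \<exists>x. M v = {x}) \<and>
      (\<forall>v\<in>ball 0 d. \<forall>w\<in>ball 0 d. \<forall>x\<in>M v. \<forall>y\<in>M w. dist x y \<le> L * dist v w))}"

definition tilt_bound :: "('a::real_inner \<Rightarrow> real) \<Rightarrow> 'a set \<Rightarrow> 'a \<Rightarrow> ereal" where
  "tilt_bound f C xb = (INF \<gamma> \<in> {\<gamma>. \<gamma> > 0 \<and> tilt_argmin f C xb \<gamma> 0 = {xb}}.
      lip_at0 (tilt_argmin f C xb \<gamma>))"

end

theory Submission
  imports Defs
begin

text \<open>
  Tilt stability with modulus \<open>\<kappa>\<close> makes the conjugate of the localized objective a \<open>C\<^sup>1\<^sup>,\<^sup>1\<close> convex function
  with \<open>\<kappa>\<close>-Lipschitz gradient, so by duality \<open>f\<close> has quadratic growth with constant \<open>1 / (2 \<kappa>)\<close> on the feasible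
  set at every feasible \<open>x\<close> near \<open>xb\<close> with a stationarity residual \<open>v\<close> near 0. It therefore suffices to
  exhibit feasible curves \<open>x\<close>, \<open>y\<close> tending to \<open>xb\<close> with \<open>y - x\<close> asymptotic to \<open>t\<^sup>n u\<close> and multipliers at
  \<open>x\<close> converging to the special multiplier, and to expand the Lagrangian to second order.

  MSCQ turns \<open>xb + t\<^sup>2 ub + t\<^sup>3 u\<close> into a feasible curve. Minimality along it forces
  \<open>Df xb = - \<alpha> e\<close> with \<open>\<alpha> \<ge> 0\<close>, where \<open>e\<close> is the gradient of \<open>g\<close> paired with the reflection of
  \<open>q = \<nabla>g(xb) ub\<close>. If \<open>\<alpha> = 0\<close>, two such curves and the zero multiplier do. If \<open>\<alpha> > 0\<close>, then \<open>q\<close> lies on the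
  boundary of the cone, \<open>\<nabla>g(xb) u\<close> is parallel to \<open>q\<close>, and the intermediate value theorem gives points
  \<open>x = xb + t ub + O(t\<^sup>2)\<close> and \<open>y = x + t\<^sup>2 u + O(t\<^sup>3)\<close> whose images lie on the boundary of the cone; the
  multiplier at \<open>x\<close> is \<open>\<alpha> / t\<close> times the reflection of \<open>g(x)\<close>.
\<close>

subsection \<open>Orders of vanishing along one-sided curves\<close>

text \<open>The one-sided estimate \<open>r t = O(t ^ n)\<close> at 0. Keeping the order as a
  natural number lets orders add under bilinear maps, so the curve expansions below reduce to
  counting exponents.\<close>

definition vanish_order :: "nat \<Rightarrow> (real \<Rightarrow> 'a::real_normed_vector) \<Rightarrow> bool" where
  "vanish_order n r \<longleftrightarrow> (\<exists>K. \<forall>\<^sub>F t in at_right 0. norm (r t) \<le> K * t ^ n)"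

lemma vanish_orderI: "\<forall>\<^sub>F t in at_right 0. norm (r t) \<le> K * t ^ n \<Longrightarrow> vanish_order n r"
  unfolding vanish_order_def by blast

lemma eventually_pos_less: "0 < d \<Longrightarrow> \<forall>\<^sub>F t in at_right (0::real). 0 < t \<and> t < d"
  by (auto simp: eventually_at_right_field)

lemma vanish_orderE:
  assumes "vanish_order n r"
  obtains K where "K > 0" "\<forall>\<^sub>F t in at_right 0. norm (r t) \<le> K * t ^ n"
proof -
  from assms obtain K where K: "\<forall>\<^sub>F t in at_right 0. norm (r t) \<le> K * t ^ n"
    unfolding vanish_order_def by blast
  have "\<forall>\<^sub>F t in at_right 0. norm (r t) \<le> (\<bar>K\<bar> + 1) * t ^ n"
    using K eventually_pos_less[of 1, simplified]
  proof eventually_elim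
    case (elim t)
    have "K * t ^ n \<le> (\<bar>K\<bar> + 1) * t ^ n"
      using elim by (intro mult_right_mono) auto
    with elim show ?case by linarith
  qed
  then show ?thesis using that[of "\<bar>K\<bar> + 1"] by simp
qed

lemma vanish_order_bound:
  assumes "vanish_order n s" "\<forall>\<^sub>F t in at_right 0. norm (r t) \<le> norm (s t)"
  shows "vanish_order n r"
proof -
  from assms(1) obtain K where "\<forall>\<^sub>F t in at_right 0. norm (s t) \<le> K * t ^ n"
    unfolding vanish_order_def by blast
  with assms(2) have "\<forall>\<^sub>F t in at_right 0. norm (r t) \<le> K * t ^ n"
    by eventually_elim linarith
  then show ?thesis by (rule vanish_orderI)
qed

lemma vanish_order_add:
  assumes "vanish_order n r" "vanish_order n s"
  shows "vanish_order n (\<lambda>t. r t + s t)"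
proof -
  from assms obtain K L where "\<forall>\<^sub>F t in at_right 0. norm (r t) \<le> K * t ^ n"
    "\<forall>\<^sub>F t in at_right 0. norm (s t) \<le> L * t ^ n"
    unfolding vanish_order_def by blast
  then have "\<forall>\<^sub>F t in at_right 0. norm (r t + s t) \<le> (K + L) * t ^ n"
    by eventually_elim (simp add: distrib_right norm_triangle_le)
  then show ?thesis by (rule vanish_orderI)
qed

lemma vanish_order_minus: "vanish_order n r \<Longrightarrow> vanish_order n (\<lambda>t. - r t)"
  by (rule vanish_order_bound[of n r]) simp_all

lemma vanish_order_diff: "vanish_order n r \<Longrightarrow> vanish_order n s \<Longrightarrow> vanish_order n (\<lambda>t. r t - s t)"
  using vanish_order_add[of n r "\<lambda>t. - s t"] by (simp add: vanish_order_minus)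

lemma vanish_order_bilinear:
  assumes "bounded_bilinear b" "vanish_order m r" "vanish_order n s"
  shows "vanish_order (m + n) (\<lambda>t. b (r t) (s t))"
proof -
  obtain C where C: "C > 0" "\<And>x y. norm (b x y) \<le> norm x * norm y * C"
    using bounded_bilinear.pos_bounded[OF assms(1)] by blast
  obtain K L where K: "K > 0" "\<forall>\<^sub>F t in at_right 0. norm (r t) \<le> K * t ^ m"
    and L: "L > 0" "\<forall>\<^sub>F t in at_right 0. norm (s t) \<le> L * t ^ n"
    using assms vanish_orderE by metis
  have "\<forall>\<^sub>F t in at_right 0. norm (b (r t) (s t)) \<le> (K * L * C) * t ^ (m + n)"
    using K(2) L(2) eventually_pos_less[of 1, simplified]
  proof eventually_elim
    case (elim t)
    have "norm (r t) * norm (s t) * C \<le> (K * t ^ m) * (L * t ^ n) * C"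
      using elim C(1) K L by (intro mult_right_mono mult_mono) auto
    with C(2)[of "r t" "s t"] show ?case by (simp add: power_add mult_ac)
  qed
  then show ?thesis by (rule vanish_orderI)
qed

lemma vanish_order_linear:
  assumes "bounded_linear b" "vanish_order n s"
  shows "vanish_order n (\<lambda>t. b (s t))"
proof -
  obtain C where C: "C > 0" "\<And>x. norm (b x) \<le> norm x * C"
    using bounded_linear.pos_bounded[OF assms(1)] by blast
  obtain L where L: "\<forall>\<^sub>F t in at_right 0. norm (s t) \<le> L * t ^ n"
    using assms vanish_orderE by metis
  have "\<forall>\<^sub>F t in at_right 0. norm (b (s t)) \<le> (L * C) * t ^ n"
    using L
  proof eventually_elim
    case (elim t)
    have "norm (s t) * C \<le> L * t ^ n * C"
      using elim C(1) by (intro mult_right_mono) auto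
    with C(2)[of "s t"] show ?case by (simp add: mult_ac)
  qed
  then show ?thesis by (rule vanish_orderI)
qed

lemma vanish_order_mono:
  assumes "vanish_order n r" "m \<le> n"
  shows "vanish_order m r"
proof -
  obtain K where K: "K > 0" "\<forall>\<^sub>F t in at_right 0. norm (r t) \<le> K * t ^ n"
    using assms vanish_orderE by metis
  have "\<forall>\<^sub>F t in at_right 0. norm (r t) \<le> K * t ^ m"
    using K(2) eventually_pos_less[of 1, simplified]
  proof eventually_elim
    case (elim t)
    have "K * t ^ n \<le> K * t ^ m"
      using elim K(1) assms(2) by (intro mult_left_mono power_decreasing) auto
    with elim show ?case by linarith
  qed
  then show ?thesis by (rule vanish_orderI)
qed

lemma vanish_order_power: "n \<le> m \<Longrightarrow> vanish_order n (\<lambda>t. t ^ m *\<^sub>R c)"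
  by (rule vanish_order_mono[of m], rule vanish_orderI[of _ "norm c"])
     (auto simp: eventually_at_right_field intro!: exI[of _ 1])

lemma vanish_order_scaleR: "vanish_order n r \<Longrightarrow> vanish_order (m + n) (\<lambda>t. t ^ m *\<^sub>R r t)"
  using vanish_order_bilinear[OF bounded_bilinear_scaleR, of m "\<lambda>t. t ^ m" n r] vanish_order_power[of m m "1::real"]
  by simp

lemma vanish_order_tendsto:
  assumes "vanish_order (Suc n) r"
  shows "((\<lambda>t. inverse (t ^ n) *\<^sub>R r t) \<longlongrightarrow> 0) (at_right 0)"
proof -
  obtain K where K: "K > 0" "\<forall>\<^sub>F t in at_right 0. norm (r t) \<le> K * t ^ Suc n"
    using assms vanish_orderE by metis
  have "\<forall>\<^sub>F t in at_right 0. norm (inverse (t ^ n) *\<^sub>R r t) \<le> K * t"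
    using K(2) eventually_pos_less[of 1, simplified]
  proof eventually_elim
    case (elim t)
    then have "inverse (t ^ n) * norm (r t) \<le> inverse (t ^ n) * (K * t ^ Suc n)"
      by (intro mult_left_mono) auto
    also have "\<dots> = K * t" using elim by (simp add: field_simps)
    finally show ?case using elim by simp
  qed
  moreover have "((\<lambda>t. K * t) \<longlongrightarrow> 0) (at_right 0)"
    by (auto intro!: tendsto_eq_intros)
  ultimately show ?thesis
    by (rule Lim_null_comparison)
qed

lemma vanish_order_tendsto_zero: "vanish_order (Suc n) r \<Longrightarrow> (r \<longlongrightarrow> 0) (at_right 0)"
  using vanish_order_tendsto[of 0 r] vanish_order_mono[of "Suc n" r "Suc 0"] by simp

lemma vanish_order_tendsto_lim:
  assumes "vanish_order (Suc n) (\<lambda>t. r t - t ^ n *\<^sub>R c)"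
  shows "((\<lambda>t. inverse (t ^ n) *\<^sub>R r t) \<longlongrightarrow> c) (at_right 0)"
proof -
  have "((\<lambda>t. inverse (t ^ n) *\<^sub>R (r t - t ^ n *\<^sub>R c) + c) \<longlongrightarrow> 0 + c) (at_right 0)"
    by (intro tendsto_intros vanish_order_tendsto assms)
  then have "((\<lambda>t. inverse (t ^ n) *\<^sub>R (r t - t ^ n *\<^sub>R c) + c) \<longlongrightarrow> c) (at_right 0)" by simp
  then show ?thesis
    by (rule Lim_transform_eventually)
       (auto simp: eventually_at_right_field scaleR_diff_right intro!: exI[of _ 1])
qed

lemma vanish_order_eventually_zero: "\<forall>\<^sub>F t in at_right 0. r t = 0 \<Longrightarrow> vanish_order n r"
  by (rule vanish_orderI[of _ 0]) (auto elim: eventually_mono)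

lemma vanish_order_divide:
  fixes r :: "real \<Rightarrow> real"
  assumes "vanish_order (Suc n) r"
  shows "vanish_order n (\<lambda>t. a / t * r t)"
proof -
  obtain K where K: "K > 0" "\<forall>\<^sub>F t in at_right 0. norm (r t) \<le> K * t ^ Suc n"
    using assms vanish_orderE by metis
  have "\<forall>\<^sub>F t in at_right 0. norm (a / t * r t) \<le> (\<bar>a\<bar> * K) * t ^ n"
    using K(2) eventually_pos_less[of 1, simplified]
  proof eventually_elim
    case (elim t)
    have "norm (a / t * r t) = \<bar>a\<bar> / t * norm (r t)" using elim by (simp add: abs_mult)
    also have "\<dots> \<le> \<bar>a\<bar> / t * (K * t ^ Suc n)" using elim by (intro mult_left_mono) auto
    also have "\<dots> = (\<bar>a\<bar> * K) * t ^ n" using elim by simp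
    finally show ?case .
  qed
  then show ?thesis by (rule vanish_orderI)
qed

lemma vanish_order_scaleR_1: "vanish_order n r \<Longrightarrow> vanish_order (Suc n) (\<lambda>t. t *\<^sub>R r t)"
  using vanish_order_scaleR[of n r 1] by simp

subsection \<open>Quadratic growth at tilt-stable minimizers\<close>

text \<open>For a small step along \<open>- p\<close> the linear decrease beats the quadratic term.
  This serves as a first-order optimality condition for functions known only to have a quadratic
  upper model, not a derivative.\<close>

lemma quadratic_perturbation_zero:
  fixes p :: "'a::real_inner"
  assumes "\<delta> > 0" "\<And>h. norm h < \<delta> \<Longrightarrow> p \<bullet> h + C * (norm h)\<^sup>2 \<ge> 0"
  shows "p = 0"
proof (rule ccontr)
  assume "p \<noteq> 0"
  \<comment> \<open>The first bound keeps the test vector \<open>- s p\<close> inside the ball of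
    radius \<delta>, the second gives \<open>C * s \<le> 1 / 2\<close>.\<close>
  define s where "s = min (\<delta> / (2 * norm p)) (1 / (2 * (\<bar>C\<bar> + 1)))"
  have s: "s > 0" "s \<le> \<delta> / (2 * norm p)" "s \<le> 1 / (2 * (\<bar>C\<bar> + 1))"
    using \<open>p \<noteq> 0\<close> assms(1) by (auto simp: s_def)
  have "norm ((- s) *\<^sub>R p) < \<delta>"
  proof -
    have "s * norm p \<le> \<delta> / (2 * norm p) * norm p" using s by (intro mult_right_mono) auto
    also have "\<dots> < \<delta>" using \<open>p \<noteq> 0\<close> assms(1) by simp
    finally show ?thesis using s by simp
  qed
  from assms(2)[OF this] have "0 \<le> - s * (norm p)\<^sup>2 + C * (s * norm p)\<^sup>2"
    using s by (simp add: dot_square_norm)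
  also have "\<dots> = s * (norm p)\<^sup>2 * (C * s - 1)" by (simp add: power2_eq_square algebra_simps)
  finally have "0 \<le> s * (norm p)\<^sup>2 * (C * s - 1)" .
  moreover have "s * (norm p)\<^sup>2 > 0" using s \<open>p \<noteq> 0\<close> by simp
  ultimately have "C * s - 1 \<ge> 0"
    by (metis linorder_not_le mult_pos_neg)
  moreover have "C * s \<le> (\<bar>C\<bar> + 1) * (1 / (2 * (\<bar>C\<bar> + 1)))"
    using s by (intro mult_mono) auto
  moreover have "(\<bar>C\<bar> + 1) * (1 / (2 * (\<bar>C\<bar> + 1))) = 1 / 2"
    by (simp add: divide_simps)
  ultimately show False by linarith
qed

text \<open>Cut \<open>[0, 1]\<close> into \<open>N + 1\<close> equal pieces: the increments add up
  to at most \<open>C / (N + 1)\<close>, which tends to 0.\<close>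

lemma quadratic_increment_imp_le:
  fixes p :: "real \<Rightarrow> real"
  assumes "\<And>s t. 0 \<le> s \<Longrightarrow> s < t \<Longrightarrow> t \<le> 1 \<Longrightarrow> p t - p s \<le> C * (t - s)\<^sup>2"
  shows "p 1 \<le> p 0"
proof -
  have *: "p 1 - p 0 \<le> C * inverse (real (Suc N))" for N
  proof -
    let ?n = "real (Suc N)"
    have "p 1 - p 0 = (\<Sum>i<Suc N. p (real (Suc i) / ?n) - p (real i / ?n))"
      by (subst sum_lessThan_telescope) simp
    also have "\<dots> \<le> (\<Sum>i<Suc N. C * (1 / ?n)\<^sup>2)"
    proof (rule sum_mono)
      fix i assume "i \<in> {..<Suc N}"
      then have i: "real i + 1 \<le> ?n" by auto
      have "p (real (Suc i) / ?n) - p (real i / ?n) \<le> C * (real (Suc i) / ?n - real i / ?n)\<^sup>2"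
        by (rule assms) (use i in \<open>auto simp: divide_simps\<close>)
      also have "real (Suc i) / ?n - real i / ?n = 1 / ?n" by (simp add: field_simps)
      finally show "p (real (Suc i) / ?n) - p (real i / ?n) \<le> C * (1 / ?n)\<^sup>2" .
    qed
    also have "\<dots> = C * inverse ?n"
      by (simp add: power2_eq_square divide_inverse del: of_nat_Suc)
    finally show ?thesis .
  qed
  have "(\<lambda>N. C * inverse (real (Suc N))) \<longlonglongrightarrow> C * 0"
    by (intro tendsto_intros LIMSEQ_inverse_real_of_nat)
  then have "p 1 - p 0 \<le> C * 0" by (rule LIMSEQ_le_const) (use * in auto)
  then show ?thesis by simp
qed

text \<open>The descent lemma without differentiability of \<psi>: the subgradient inequality and
  the Lipschitz bound control increments along the segment, and
  \<open>quadratic_increment_imp_le\<close> sums them.\<close>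

lemma lipschitz_subgradient_descent:
  fixes M :: "'a::real_inner \<Rightarrow> 'a"
  assumes sub: "\<And>v w. v \<in> S \<Longrightarrow> w \<in> S \<Longrightarrow> \<psi> w - \<psi> v \<le> M w \<bullet> (w - v)"
    and lip: "\<And>v w. v \<in> S \<Longrightarrow> w \<in> S \<Longrightarrow> norm (M v - M w) \<le> \<kappa> * norm (v - w)"
    and S: "convex S" "v \<in> S" "w \<in> S"
  shows "\<psi> w \<le> \<psi> v + M v \<bullet> (w - v) + \<kappa> / 2 * (norm (w - v))\<^sup>2"
proof -
  define h where "h = w - v"
  define p where "p t = \<psi> (v + t *\<^sub>R h) - t * (M v \<bullet> h) - \<kappa> * t\<^sup>2 / 2 * (norm h)\<^sup>2" for t
  have inS: "v + t *\<^sub>R h \<in> S" if "0 \<le> t" "t \<le> 1" for t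
  proof -
    have "v + t *\<^sub>R h = (1 - t) *\<^sub>R v + t *\<^sub>R w" by (simp add: h_def algebra_simps)
    then show ?thesis using convexD_alt[OF S, of t] that by simp
  qed
  have "p 1 \<le> p 0"
  proof (rule quadratic_increment_imp_le)
    fix s t :: real assume st: "0 \<le> s" "s < t" "t \<le> 1"
    let ?w1 = "v + s *\<^sub>R h" and ?w2 = "v + t *\<^sub>R h"
    have "\<psi> ?w2 - \<psi> ?w1 \<le> M ?w2 \<bullet> (?w2 - ?w1)" using st by (intro sub inS) auto
    also have "?w2 - ?w1 = (t - s) *\<^sub>R h" by (simp add: algebra_simps)
    also have "M ?w2 \<bullet> \<dots> = (t - s) * ((M ?w2 - M v) \<bullet> h) + (t - s) * (M v \<bullet> h)"
      by (simp add: algebra_simps)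
    also have "(M ?w2 - M v) \<bullet> h \<le> norm (M ?w2 - M v) * norm h" by (rule norm_cauchy_schwarz)
    also have "\<dots> \<le> (\<kappa> * norm (?w2 - v)) * norm h"
      using st by (intro mult_right_mono lip inS S) auto
    also have "\<dots> = \<kappa> * t * (norm h)\<^sup>2" using st by (simp add: power2_eq_square)
    finally have "\<psi> ?w2 - \<psi> ?w1 \<le> (t - s) * (\<kappa> * t * (norm h)\<^sup>2) + (t - s) * (M v \<bullet> h)"
      using st by simp
    \<comment> \<open>Here \<open>t * (t - s) - (t\<^sup>2 - s\<^sup>2) / 2 = (t - s)\<^sup>2 /
      2\<close>.\<close>
    then show "p t - p s \<le> \<kappa> / 2 * (norm h)\<^sup>2 * (t - s)\<^sup>2"
      by (simp add: p_def power2_eq_square field_simps)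
  qed
  then show ?thesis by (simp add: p_def h_def)
qed

lemma tilt_stable_selection:
  assumes "tilt_stable f C xb \<kappa>"
  obtains \<gamma> d M where "\<gamma> > 0" "d > 0" "M 0 = xb"
    "\<And>v. v \<in> ball 0 d \<Longrightarrow> M v \<in> C \<and> norm (M v - xb) \<le> \<gamma>"
    "\<And>v y. v \<in> ball 0 d \<Longrightarrow> y \<in> C \<Longrightarrow> norm (y - xb) \<le> \<gamma> \<Longrightarrow> f (M v) - v \<bullet> M v \<le> f y - v \<bullet> y"
    "\<And>v w. v \<in> ball 0 d \<Longrightarrow> w \<in> ball 0 d \<Longrightarrow> norm (M v - M w) \<le> \<kappa> * norm (v - w)"
proof -
  obtain \<gamma> V where \<gamma>: "\<gamma> > 0" "tilt_argmin f C xb \<gamma> 0 = {xb}" and V: "open V" "0 \<in> V"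
    and single: "\<forall>v\<in>V. \<exists>x. tilt_argmin f C xb \<gamma> v = {x}"
    and lip: "\<forall>v\<in>V. \<forall>w\<in>V. \<forall>x\<in>tilt_argmin f C xb \<gamma> v. \<forall>y\<in>tilt_argmin f C xb \<gamma> w.
            dist x y \<le> \<kappa> * dist v w"
    using assms unfolding tilt_stable_def by blast
  obtain d where d: "d > 0" "ball 0 d \<subseteq> V" using V open_contains_ball by blast
  define M where "M v = (THE x. x \<in> tilt_argmin f C xb \<gamma> v)" for v
  have M: "tilt_argmin f C xb \<gamma> v = {M v}" if v: "v \<in> V" for v
  proof -
    obtain x where x: "tilt_argmin f C xb \<gamma> v = {x}" using bspec[OF single v] by blast
    then have "M v = x" unfolding M_def by (intro the_equality) auto
    with x show ?thesis by simp
  qed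
  have mem: "M v \<in> tilt_argmin f C xb \<gamma> v" if "v \<in> ball 0 d" for v using M that d by blast
  show ?thesis
  proof (rule that[of \<gamma> d M])
    show "M 0 = xb" using M[OF V(2)] \<gamma>(2) by simp
    show "M v \<in> C \<and> norm (M v - xb) \<le> \<gamma>" if "v \<in> ball 0 d" for v
      using mem[OF that] by (auto simp: tilt_argmin_def dist_norm norm_minus_commute)
    show "f (M v) - v \<bullet> M v \<le> f y - v \<bullet> y"
      if "v \<in> ball 0 d" "y \<in> C" "norm (y - xb) \<le> \<gamma>" for v y
      using mem[OF that(1)] that(2,3)
      by (auto simp: tilt_argmin_def dist_norm norm_minus_commute)
    show "norm (M v - M w) \<le> \<kappa> * norm (v - w)" if "v \<in> ball 0 d" "w \<in> ball 0 d" for v w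
      using lip mem[OF that(1)] mem[OF that(2)] that d(2) unfolding dist_norm by blast
  qed (use \<gamma> d in auto)
qed

text \<open>Any pair \<open>(x, v)\<close> near \<open>(xb, 0)\<close> that satisfies a proximal inequality with an arbitrarily bad
  constant \<open>c\<close> already lies on the graph of the argmin map: minimizing \<open>r \<psi>(w) + |w - (v + r x)|\<^sup>2 / 2\<close>
  with \<open>\<psi>\<close> the conjugate of the localized objective yields \<open>v'\<close> with \<open>v' + r M(v') = v + r x\<close>, and for
  \<open>r > c\<close> the two growth inequalities force \<open>v' = v\<close>.\<close>

lemma tilt_stable_growth:
  fixes f :: "'a::euclidean_space \<Rightarrow> real"
  assumes tilt: "tilt_stable f C xb \<kappa>" and pos: "\<kappa> > 0" "c \<ge> 0" "\<rho>\<^sub>0 > 0"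
  obtains \<rho> where "\<rho> > 0"
    "\<And>x v y. x \<in> C \<Longrightarrow> norm (x - xb) < \<rho> \<Longrightarrow> norm v < \<rho> \<Longrightarrow>
       (\<forall>x'\<in>C. norm (x' - xb) < \<rho>\<^sub>0 \<longrightarrow>
           f x' \<ge> f x + v \<bullet> (x' - x) - c * (norm (x' - x))\<^sup>2) \<Longrightarrow>
       y \<in> C \<Longrightarrow> norm (y - xb) < \<rho> \<Longrightarrow>
       f y \<ge> f x + v \<bullet> (y - x) + (norm (y - x))\<^sup>2 / (2 * \<kappa>)"
proof -
  obtain \<gamma> d M where \<gamma>: "\<gamma> > 0" and d: "d > 0" and M0: "M 0 = xb"
    and MC: "\<And>v. v \<in> ball 0 d \<Longrightarrow> M v \<in> C \<and> norm (M v - xb) \<le> \<gamma>"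
    and Mmin: "\<And>v y. v \<in> ball 0 d \<Longrightarrow> y \<in> C \<Longrightarrow> norm (y - xb) \<le> \<gamma> \<Longrightarrow> f (M v) - v \<bullet> M v \<le> f y - v \<bullet> y"
    and lip: "\<And>v w. v \<in> ball 0 d \<Longrightarrow> w \<in> ball 0 d \<Longrightarrow> norm (M v - M w) \<le> \<kappa> * norm (v - w)"
    by (rule tilt_stable_selection[OF tilt]) (rule that)
  \<comment> \<open>\<psi> is the conjugate of the localized objective, and \<open>M v\<close>
    attains the maximum defining it; hence \<open>M w\<close> is a subgradient of \<psi> at
    \<open>w\<close>, which is \<open>sub\<close>.\<close>
  define \<psi> where "\<psi> v = v \<bullet> M v - f (M v)" for v
  have sub: "\<psi> w - \<psi> v \<le> M w \<bullet> (w - v)" if "v \<in> ball 0 d" "w \<in> ball 0 d" for v w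
    using Mmin[OF that(1), of "M w"] MC[OF that(2)]
    by (simp add: \<psi>_def algebra_simps inner_commute)
  note descent = lipschitz_subgradient_descent[of "ball 0 d" \<psi> M \<kappa>, OF sub lip convex_ball]
  \<comment> \<open>Fenchel-Young at the tilted point \<open>v + (y - M v) / \<kappa>\<close>,
    combined with the descent lemma. This shift maximizes the resulting lower bound and turns the
    Lipschitz constant \<kappa> into the growth constant \<open>1 / (2 * \<kappa>)\<close>.\<close>
  have growth: "f y \<ge> f (M v) + v \<bullet> (y - M v) + (norm (y - M v))\<^sup>2 / (2 * \<kappa>)"
    if v: "v \<in> ball 0 d" and y: "y \<in> C" "norm (y - xb) \<le> \<gamma>"
      and w: "v + (1 / \<kappa>) *\<^sub>R (y - M v) \<in> ball 0 d" for v y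
  proof -
    let ?w = "v + (1 / \<kappa>) *\<^sub>R (y - M v)"
    have "?w \<bullet> y - f y \<le> \<psi> ?w" using Mmin[OF w y] by (simp add: \<psi>_def)
    also have "\<dots> \<le> \<psi> v + M v \<bullet> (?w - v) + \<kappa> / 2 * (norm (?w - v))\<^sup>2"
      using descent[OF _ _ _ _ v w] by simp
    also have "\<kappa> / 2 * (norm (?w - v))\<^sup>2 = (norm (y - M v))\<^sup>2 / (2 * \<kappa>)"
      using pos by (simp add: power2_eq_square)
    finally have "f y \<ge> ?w \<bullet> y - (\<psi> v + (M v \<bullet> (y - M v)) / \<kappa> + (norm (y - M v))\<^sup>2 / (2 * \<kappa>))"
      using pos by simp
    also have "?w \<bullet> y = v \<bullet> y + ((y - M v) \<bullet> y) / \<kappa>" by (simp add: inner_add_left)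
    finally have "f y \<ge> v \<bullet> y + ((y - M v) \<bullet> y - M v \<bullet> (y - M v)) / \<kappa> - \<psi> v - (norm (y - M v))\<^sup>2 / (2 * \<kappa>)"
      by (simp add: diff_divide_distrib)
    also have "(y - M v) \<bullet> y - M v \<bullet> (y - M v) = (norm (y - M v))\<^sup>2"
      by (simp add: dot_square_norm[symmetric] algebra_simps inner_commute)
    finally show ?thesis by (simp add: \<psi>_def algebra_simps inner_commute)
  qed
  \<comment> \<open>The excess \<open>r - c = 1\<close> leaves a positive coefficient once the two
    growth inequalities are added. The radius \<open>b\<close> keeps the dual variable in the domain
    of \<open>M\<close> and its image within \<open>\<rho>\<^sub>0\<close> of \<open>xb\<close>;
    \<rho> keeps the dual minimizer off the sphere of radius \<open>b\<close> and the shifted points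
    of \<open>growth\<close> inside \<open>ball 0 d\<close>.\<close>
  define r where "r = c + 1"
  define b where "b = min (d / 4) (\<rho>\<^sub>0 / (2 * \<kappa>))"
  define \<rho> where "\<rho> = min \<gamma> (min (\<kappa> * d / 4) (b / (2 * (1 + r))))"
  have r: "r > 0" using pos by (simp add: r_def)
  have b: "b > 0" "b \<le> d / 4" "b \<le> \<rho>\<^sub>0 / (2 * \<kappa>)" using d pos by (auto simp: b_def)
  have \<rho>: "\<rho> > 0" "\<rho> \<le> \<gamma>" "\<rho> \<le> \<kappa> * d / 4" "\<rho> \<le> b / (2 * (1 + r))"
    using \<gamma> d pos b r unfolding \<rho>_def
    by (simp_all only: min.cobounded1 min.coboundedI2 min.cobounded2) simp
  show ?thesis
  proof (rule that[OF \<rho>(1)])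
    fix x v y
    assume x: "x \<in> C" "norm (x - xb) < \<rho>" and v: "norm v < \<rho>"
      and prox: "\<forall>x'\<in>C. norm (x' - xb) < \<rho>\<^sub>0 \<longrightarrow>
           f x' \<ge> f x + v \<bullet> (x' - x) - c * (norm (x' - x))\<^sup>2"
      and y: "y \<in> C" "norm (y - xb) < \<rho>"
    define z where "z = v + r *\<^sub>R x"
    define \<theta> where "\<theta> w = r * \<psi> w + (norm (w - z))\<^sup>2 / 2" for w
    have bd: "w \<in> ball 0 d" if "w \<in> cball 0 b" for w using that b d by auto
    have Mb: "norm (M w - xb) \<le> \<kappa> * b" if "w \<in> cball 0 b" for w
    proof -
      have "norm (M w - M 0) \<le> \<kappa> * norm (w - 0)" using bd[OF that] d by (intro lip) auto
      also have "\<dots> \<le> \<kappa> * b" using that pos by (intro mult_left_mono) auto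
      finally show ?thesis by (simp add: M0)
    qed
    \<comment> \<open>\<psi> is Lipschitz here because its subgradients \<open>M w\<close> are
      bounded on the ball.\<close>
    have "continuous_on (cball 0 b) \<psi>"
    proof (rule lipschitz_on_continuous_on, rule lipschitz_onI)
      fix w1 w2 :: 'a assume w: "w1 \<in> cball 0 b" "w2 \<in> cball 0 b"
      have bdd: "norm (M w) \<le> norm xb + \<kappa> * b" if "w \<in> cball 0 b" for w
        using Mb[OF that] norm_triangle_sub[of "M w" xb] by linarith
      have "\<psi> v1 - \<psi> v2 \<le> (norm xb + \<kappa> * b) * norm (v1 - v2)"
        if "v1 \<in> cball 0 b" "v2 \<in> cball 0 b" for v1 v2
      proof -
        have "\<psi> v1 - \<psi> v2 \<le> M v1 \<bullet> (v1 - v2)" by (rule sub[OF bd bd]) (use that in auto)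
        also have "\<dots> \<le> norm (M v1) * norm (v1 - v2)" by (rule norm_cauchy_schwarz)
        also have "\<dots> \<le> (norm xb + \<kappa> * b) * norm (v1 - v2)"
          by (intro mult_right_mono bdd that) auto
        finally show ?thesis .
      qed
      from this[OF w] this[OF w(2,1)]
      show "dist (\<psi> w1) (\<psi> w2) \<le> (norm xb + \<kappa> * b) * dist w1 w2"
        by (simp add: dist_norm norm_minus_commute abs_le_iff)
    qed (use b pos in auto)
    then have "continuous_on (cball 0 b) \<theta>"
      unfolding \<theta>_def by (auto intro!: continuous_intros)
    moreover have "cball (0::'a) b \<noteq> {}" using b by simp
    ultimately obtain v' where v': "v' \<in> cball 0 b" "\<And>w. w \<in> cball 0 b \<Longrightarrow> \<theta> v' \<le> \<theta> w"
      using continuous_attains_inf[of "cball 0 b" \<theta>] compact_cball by blast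
    define x' where "x' = M v'"
    have xv: "norm (v + r *\<^sub>R (x - xb)) < b / 2"
    proof -
      have "norm (v + r *\<^sub>R (x - xb)) \<le> norm v + r * norm (x - xb)"
        using r norm_triangle_ineq[of v "r *\<^sub>R (x - xb)"] by simp
      also have "\<dots> < \<rho> + r * \<rho>" using v x r by (intro add_strict_mono mult_strict_left_mono) auto
      also have "\<dots> = \<rho> * (1 + r)" by (simp add: algebra_simps)
      also have "\<dots> \<le> b / (2 * (1 + r)) * (1 + r)" using r \<rho> by (intro mult_right_mono) auto
      also have "\<dots> = b / 2" using r by (simp add: field_simps)
      finally show ?thesis .
    qed
    \<comment> \<open>On the sphere of radius \<open>b\<close>, the subgradient \<open>xb\<close> at
      0 gives \<open>\<theta> v' - \<theta> 0 \<ge> b\<^sup>2 / 2 - b * norm (v + r (x -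
      xb))\<close>, which is positive; so the minimizer is interior.\<close>
    have "norm v' < b"
    proof (rule ccontr)
      assume "\<not> norm v' < b"
      then have nv: "norm v' = b" using v' by simp
      have "\<psi> 0 - \<psi> v' \<le> M 0 \<bullet> (0 - v')" using bd[OF v'(1)] d by (intro sub) auto
      then have 1: "r * (\<psi> 0 - \<psi> v') \<le> r * (- (xb \<bullet> v'))" using r by (intro mult_left_mono) (auto simp: M0)
      have "(norm (v' - z))\<^sup>2 = b\<^sup>2 - 2 * (v' \<bullet> z) + (norm z)\<^sup>2"
        by (simp add: nv[symmetric] dot_square_norm[symmetric] algebra_simps inner_commute)
      then have "\<theta> v' - \<theta> 0 = r * (\<psi> v' - \<psi> 0) + b\<^sup>2 / 2 - v' \<bullet> z"
        by (simp add: \<theta>_def algebra_simps diff_divide_distrib add_divide_distrib)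
      also have "\<dots> \<ge> r * (xb \<bullet> v') + b\<^sup>2 / 2 - v' \<bullet> z" using 1 by (simp add: algebra_simps)
      also have "r * (xb \<bullet> v') + b\<^sup>2 / 2 - v' \<bullet> z = b\<^sup>2 / 2 - v' \<bullet> (v + r *\<^sub>R (x - xb))"
        by (simp add: z_def algebra_simps inner_commute)
      finally have "b\<^sup>2 / 2 - v' \<bullet> (v + r *\<^sub>R (x - xb)) \<le> \<theta> v' - \<theta> 0" .
      moreover have "v' \<bullet> (v + r *\<^sub>R (x - xb)) \<le> b * norm (v + r *\<^sub>R (x - xb))"
        using norm_cauchy_schwarz[of v'] nv by simp
      moreover have "b * norm (v + r *\<^sub>R (x - xb)) < b * (b / 2)"
        using xv b by (intro mult_strict_left_mono) auto
      moreover have "\<theta> v' \<le> \<theta> 0" using v'(2)[of 0] b by simp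
      ultimately show False by (simp add: power2_eq_square)
    qed
    \<comment> \<open>The optimality condition at the interior minimizer; the upper model of \<psi>
      from the descent lemma replaces a derivative.\<close>
    have "r *\<^sub>R x' + v' - z = 0"
    proof (rule quadratic_perturbation_zero)
      show "0 < b - norm v'" using \<open>norm v' < b\<close> by simp
      fix h :: 'a assume h: "norm h < b - norm v'"
      have w: "v' + h \<in> cball 0 b" using h norm_triangle_ineq[of v' h] by simp
      have "\<psi> (v' + h) \<le> \<psi> v' + x' \<bullet> h + \<kappa> / 2 * (norm h)\<^sup>2"
        using descent[OF _ _ _ _ bd[OF v'(1)] bd[OF w]] by (simp add: x'_def)
      then have "r * \<psi> (v' + h) \<le> r * (\<psi> v' + x' \<bullet> h + \<kappa> / 2 * (norm h)\<^sup>2)"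
        using r by (intro mult_left_mono) auto
      moreover have "(norm (v' + h - z))\<^sup>2 = (norm (v' - z))\<^sup>2 + 2 * ((v' - z) \<bullet> h) + (norm h)\<^sup>2"
        by (simp add: dot_square_norm[symmetric] algebra_simps inner_commute)
      moreover have "\<theta> v' \<le> \<theta> (v' + h)" using v'(2)[OF w] .
      ultimately show "(r *\<^sub>R x' + v' - z) \<bullet> h + (r * \<kappa> / 2 + 1 / 2) * (norm h)\<^sup>2 \<ge> 0"
        by (simp add: \<theta>_def algebra_simps)
    qed
    then have vv: "v - v' = r *\<^sub>R (x' - x)" by (simp add: z_def algebra_simps)
    have x': "x' \<in> C" "norm (x' - xb) \<le> \<kappa> * b" using MC[OF bd[OF v'(1)]] Mb[OF v'(1)] by (auto simp: x'_def)
    have g: "f u \<ge> f x' + v' \<bullet> (u - x') + (norm (u - x'))\<^sup>2 / (2 * \<kappa>)"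
      if u: "u \<in> C" "norm (u - xb) < \<rho>" for u
      unfolding x'_def
    proof (rule growth[OF bd[OF v'(1)] u(1)])
      show "norm (u - xb) \<le> \<gamma>" using u \<rho> by linarith
      have "norm (u - M v') \<le> norm (u - xb) + norm (x' - xb)"
        using norm_triangle_ineq4[of "u - xb" "x' - xb"] by (simp add: x'_def)
      also have "\<dots> < \<kappa> * d / 4 + \<kappa> * b" using u \<rho> x' by linarith
      also have "\<dots> \<le> \<kappa> * d / 4 + \<kappa> * (d / 4)"
        using b pos by (intro add_left_mono mult_left_mono) auto
      finally have "norm (u - M v') / \<kappa> < d / 2" using pos by (simp add: field_simps)
      moreover have "norm (v' + (1 / \<kappa>) *\<^sub>R (u - M v')) \<le> norm v' + norm (u - M v') / \<kappa>"
        using norm_triangle_ineq[of v' "(1 / \<kappa>) *\<^sub>R (u - M v')"] pos by simp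
      ultimately have "norm (v' + (1 / \<kappa>) *\<^sub>R (u - M v')) < d"
        using \<open>norm v' < b\<close> b by linarith
      then show "v' + (1 / \<kappa>) *\<^sub>R (u - M v') \<in> ball 0 d" by simp
    qed
    have "norm (x' - xb) < \<rho>\<^sub>0"
    proof -
      have "\<kappa> * b \<le> \<kappa> * (\<rho>\<^sub>0 / (2 * \<kappa>))" using b pos by (intro mult_left_mono) auto
      also have "\<dots> < \<rho>\<^sub>0" using pos by simp
      finally show ?thesis using x' by linarith
    qed
    \<comment> \<open>Adding the proximal inequality at \<open>x\<close> and the growth inequality
      at \<open>x'\<close> cancels the values of \<open>f\<close>; since
      \<open>v - v' = r (x' - x)\<close>, the remaining coefficient of the squared distance is
      \<open>r - c + 1 / (2 * \<kappa>) > 0\<close>.\<close>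
    from prox[rule_format, OF x'(1) this] g[OF x]
    have "(v - v') \<bullet> (x' - x) + (norm (x' - x))\<^sup>2 / (2 * \<kappa>) - c * (norm (x' - x))\<^sup>2 \<le> 0"
      by (simp add: algebra_simps norm_minus_commute)
    then have "(norm (x' - x))\<^sup>2 * (1 + 1 / (2 * \<kappa>)) \<le> 0"
      unfolding vv inner_scaleR_left dot_square_norm r_def by (simp add: distrib_left distrib_right)
    moreover have "1 + 1 / (2 * \<kappa>) > 0" using pos by (simp add: add_pos_pos)
    ultimately have "x' = x" by (simp add: mult_le_0_iff)
    with vv have "v' = v" by simp
    with g[OF y] \<open>x' = x\<close> show "f y \<ge> f x + v \<bullet> (y - x) + (norm (y - x))\<^sup>2 / (2 * \<kappa>)" by simp
  qed
qed

subsection \<open>Second-order expansions\<close>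

lemma bounded_bilinear_matrix_vector_mult:
  "bounded_bilinear ((*v) :: real^'n^'m \<Rightarrow> real^'n \<Rightarrow> real^'m)"
  unfolding bilinear_conv_bounded_bilinear[symmetric] bilinear_def
  by (auto intro!: linearI simp: matrix_vector_mult_add_rdistrib matrix_vector_mult_scaleR
      scaleR_matrix_vector_assoc matrix_vector_right_distrib)

lemma bounded_linear_transpose: "bounded_linear (transpose :: real^'n^'m \<Rightarrow> real^'m^'n)"
  unfolding linear_conv_bounded_linear[symmetric]
  by (auto intro!: linearI simp: transpose_def vec_eq_iff)

lemma C2_onD:
  assumes "C2_on f Df Hf U" "x \<in> U"
  shows "(f has_derivative (\<lambda>h. Df x \<bullet> h)) (at x)"
    "(Df has_derivative (\<lambda>h. Hf x *v h)) (at x)" "continuous_on U Hf" "open U"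
  using assms unfolding C2_on_def by auto

text \<open>Second-order Maclaurin expansion on the segment, followed by replacing the Hessian at
  the intermediate point by the one at \<open>xb\<close>. The estimate is uniform in both endpoints,
  which allows moving base points later.\<close>

lemma C2_taylor:
  assumes C2: "C2_on f Df Hf U" and xb: "xb \<in> U" and "\<epsilon> > 0"
  obtains \<delta> where "\<delta> > 0"
    "\<And>x y. x \<in> ball xb \<delta> \<Longrightarrow> y \<in> ball xb \<delta> \<Longrightarrow>
      \<bar>f y - f x - Df x \<bullet> (y - x) - ((y - x) \<bullet> (Hf xb *v (y - x))) / 2\<bar> \<le> \<epsilon> * (norm (y - x))\<^sup>2"
proof -
  obtain K where K: "K > 0" "\<And>(M :: real^'a^'a) h. norm (M *v h) \<le> norm M * norm h * K"
    using bounded_bilinear.pos_bounded[OF bounded_bilinear_matrix_vector_mult] by blast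
  have "open U" "continuous_on U Hf" using C2_onD[OF C2 xb] by auto
  then have "isCont Hf xb" using xb continuous_on_eq_continuous_at by blast
  \<comment> \<open>\<open>K\<close> bridges the norm of a matrix and the size of its action; the
    factor 2 cancels the 1/2 in the Taylor term.\<close>
  then obtain \<delta>\<^sub>1 where d1: "\<delta>\<^sub>1 > 0" "\<And>z. dist z xb < \<delta>\<^sub>1 \<Longrightarrow> dist (Hf z) (Hf xb) < 2 * \<epsilon> / K"
    using \<open>\<epsilon> > 0\<close> K(1) unfolding continuous_at_eps_delta
    by (metis divide_pos_pos mult_pos_pos zero_less_numeral)
  obtain \<delta>\<^sub>2 where d2: "\<delta>\<^sub>2 > 0" "ball xb \<delta>\<^sub>2 \<subseteq> U" using \<open>open U\<close> xb open_contains_ball by blast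
  define \<delta> where "\<delta> = min \<delta>\<^sub>1 \<delta>\<^sub>2"
  show ?thesis
  proof (rule that[of \<delta>])
    show "\<delta> > 0" using d1 d2 by (simp add: \<delta>_def)
    fix x y assume x: "x \<in> ball xb \<delta>" and y: "y \<in> ball xb \<delta>"
    define h where "h = y - x"
    have seg: "x + s *\<^sub>R h \<in> ball xb \<delta>" if "0 \<le> s" "s \<le> 1" for s
    proof -
      have "x + s *\<^sub>R h = (1 - s) *\<^sub>R x + s *\<^sub>R y" by (simp add: h_def algebra_simps)
      then show ?thesis using convexD_alt[OF convex_ball x y, of s] that by simp
    qed
    \<comment> \<open>\<open>D m\<close> is the \<open>m\<close>-th derivative of \<open>f\<close>
      along the segment; only orders up to 2 are queried, so the last branch may serve all
      \<open>m \<ge> 2\<close>.\<close>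
    define D where "D m = (if m = 0 then (\<lambda>s. f (x + s *\<^sub>R h)) else if m = Suc 0 then (\<lambda>s. Df (x + s *\<^sub>R h) \<bullet> h)
      else (\<lambda>s. h \<bullet> (Hf (x + s *\<^sub>R h) *v h)))" for m :: nat
    have deriv: "DERIV (D m) s :> D (Suc m) s" if "m < 2" "0 \<le> s" "s \<le> 1" for m s
    proof -
      have inU: "x + s *\<^sub>R h \<in> U" using seg[OF that(2,3)] d2 by (auto simp: \<delta>_def)
      have line: "((\<lambda>s. x + s *\<^sub>R h) has_derivative (\<lambda>s. s *\<^sub>R h)) (at s)"
        by (auto intro!: derivative_eq_intros)
      consider "m = 0" | "m = Suc 0" using \<open>m < 2\<close> by linarith
      then show ?thesis
      proof cases
        case 1
        have "((\<lambda>s. f (x + s *\<^sub>R h)) has_derivative (\<lambda>r. Df (x + s *\<^sub>R h) \<bullet> (r *\<^sub>R h))) (at s)"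
          by (rule has_derivative_compose[OF line C2_onD(1)[OF C2 inU]])
        then show ?thesis using 1 by (auto simp: D_def intro: has_derivative_imp_has_field_derivative)
      next
        case 2
        have "((\<lambda>s. Df (x + s *\<^sub>R h)) has_derivative (\<lambda>r. Hf (x + s *\<^sub>R h) *v (r *\<^sub>R h))) (at s)"
          by (rule has_derivative_compose[OF line C2_onD(2)[OF C2 inU]])
        then have "((\<lambda>s. Df (x + s *\<^sub>R h) \<bullet> h) has_derivative (\<lambda>r. (Hf (x + s *\<^sub>R h) *v (r *\<^sub>R h)) \<bullet> h)) (at s)"
          by (rule has_derivative_inner_left)
        then show ?thesis using 2
          by (auto simp: D_def matrix_vector_mult_scaleR inner_commute intro: has_derivative_imp_has_field_derivative)
      qed
    qed
    have "\<exists>s. 0 < s \<and> s < 1 \<and> D 0 1 = (\<Sum>m<2. D m 0 / fact m * 1 ^ m) + D 2 s / fact 2 * 1 ^ 2"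
      by (rule Maclaurin) (use deriv in auto)
    then obtain s where s: "0 < s" "s < 1" "D 0 1 = (\<Sum>m<2. D m 0 / fact m * 1 ^ m) + D 2 s / fact 2 * 1 ^ 2"
      by blast
    then have eq: "f y = f x + Df x \<bullet> h + (h \<bullet> (Hf (x + s *\<^sub>R h) *v h)) / 2"
      by (simp add: D_def h_def numeral_2_eq_2)
    let ?M = "Hf (x + s *\<^sub>R h) - Hf xb"
    have "norm ?M \<le> 2 * \<epsilon> / K"
      using d1(2)[of "x + s *\<^sub>R h"] seg[of s] s by (auto simp: \<delta>_def dist_norm norm_minus_commute)
    then have "norm ?M * K \<le> 2 * \<epsilon>" using K(1) by (simp add: field_simps)
    have "\<bar>h \<bullet> (?M *v h)\<bar> \<le> norm h * norm (?M *v h)" by (rule Cauchy_Schwarz_ineq2)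
    also have "\<dots> \<le> norm h * (norm ?M * norm h * K)" by (intro mult_left_mono K) auto
    also have "\<dots> = (norm ?M * K) * (norm h)\<^sup>2" by (simp add: power2_eq_square)
    also have "\<dots> \<le> 2 * \<epsilon> * (norm h)\<^sup>2" using \<open>norm ?M * K \<le> 2 * \<epsilon>\<close> by (intro mult_right_mono) auto
    finally have "\<bar>h \<bullet> (?M *v h)\<bar> / 2 \<le> \<epsilon> * (norm h)\<^sup>2" by simp
    moreover have "f y - f x - Df x \<bullet> h - (h \<bullet> (Hf xb *v h)) / 2 = (h \<bullet> (?M *v h)) / 2"
      by (simp add: eq matrix_vector_mult_diff_rdistrib inner_diff_right diff_divide_distrib)
    ultimately show "\<bar>f y - f x - Df x \<bullet> (y - x) - ((y - x) \<bullet> (Hf xb *v (y - x))) / 2\<bar> \<le> \<epsilon> * (norm (y - x))\<^sup>2"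
      by (simp add: h_def)
  qed
qed

lemma C2_taylor_first:
  assumes C2: "C2_on f Df Hf U" and xb: "xb \<in> U"
  obtains K \<delta> where "K > 0" "\<delta> > 0"
    "\<And>x y. x \<in> ball xb \<delta> \<Longrightarrow> y \<in> ball xb \<delta> \<Longrightarrow> \<bar>f y - f x - Df x \<bullet> (y - x)\<bar> \<le> K * (norm (y - x))\<^sup>2"
proof -
  obtain C where C: "C > 0" "\<And>h. norm (Hf xb *v h) \<le> norm h * C"
    using bounded_linear.pos_bounded[OF matrix_vector_mul_bounded_linear] by blast
  obtain \<delta> where d: "\<delta> > 0"
    "\<And>x y. x \<in> ball xb \<delta> \<Longrightarrow> y \<in> ball xb \<delta> \<Longrightarrow>
      \<bar>f y - f x - Df x \<bullet> (y - x) - ((y - x) \<bullet> (Hf xb *v (y - x))) / 2\<bar> \<le> 1 * (norm (y - x))\<^sup>2"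
    using C2_taylor[OF C2 xb, of 1] by (metis zero_less_one)
  show ?thesis
  proof (rule that[of "1 + C" \<delta>])
    fix x y assume xy: "x \<in> ball xb \<delta>" "y \<in> ball xb \<delta>"
    let ?h = "y - x"
    have "\<bar>?h \<bullet> (Hf xb *v ?h)\<bar> \<le> norm ?h * norm (Hf xb *v ?h)" by (rule Cauchy_Schwarz_ineq2)
    also have "\<dots> \<le> norm ?h * (norm ?h * C)" by (intro mult_left_mono C) auto
    also have "\<dots> = C * (norm ?h)\<^sup>2" by (simp add: power2_eq_square)
    finally have "\<bar>?h \<bullet> (Hf xb *v ?h)\<bar> \<le> C * (norm ?h)\<^sup>2" .
    with d(2)[OF xy] show "\<bar>f y - f x - Df x \<bullet> ?h\<bar> \<le> (1 + C) * (norm ?h)\<^sup>2"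
      by (simp add: distrib_right)
  qed (use C d in auto)
qed

text \<open>Freezing the gradient at \<open>xb\<close> costs
  \<open>norm (Df x - Df xb) = O(norm (x - xb))\<close> times the step. The product form of the
  error is what lets orders of vanishing add in \<open>vanish_order_G_diff\<close>.\<close>

lemma C2_strict_differentiable:
  assumes C2: "C2_on f Df Hf U" and xb: "xb \<in> U"
  obtains K \<delta> where "K > 0" "\<delta> > 0"
    "\<And>x y. x \<in> ball xb \<delta> \<Longrightarrow> y \<in> ball xb \<delta> \<Longrightarrow>
      \<bar>f y - f x - Df xb \<bullet> (y - x)\<bar> \<le> K * norm (y - x) * (norm (x - xb) + norm (y - xb))"
proof -
  obtain C where C: "C > 0" "\<And>h. norm (Hf xb *v h) \<le> norm h * C"
    using bounded_linear.pos_bounded[OF matrix_vector_mul_bounded_linear] by blast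
  obtain K \<delta>\<^sub>1 where K: "K > 0" "\<delta>\<^sub>1 > 0"
    "\<And>x y. x \<in> ball xb \<delta>\<^sub>1 \<Longrightarrow> y \<in> ball xb \<delta>\<^sub>1 \<Longrightarrow> \<bar>f y - f x - Df x \<bullet> (y - x)\<bar> \<le> K * (norm (y - x))\<^sup>2"
    using C2_taylor_first[OF C2 xb] by blast
  obtain \<delta>\<^sub>2 where d2: "\<delta>\<^sub>2 > 0"
    "\<And>x. norm (x - xb) < \<delta>\<^sub>2 \<Longrightarrow> norm (Df x - Df xb - Hf xb *v (x - xb)) \<le> 1 * norm (x - xb)"
    using C2_onD(2)[OF C2 xb] unfolding has_derivative_at_alt by (metis zero_less_one)
  show ?thesis
  proof (rule that[of "K + C + 1" "min \<delta>\<^sub>1 \<delta>\<^sub>2"])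
    fix x y assume xy: "x \<in> ball xb (min \<delta>\<^sub>1 \<delta>\<^sub>2)" "y \<in> ball xb (min \<delta>\<^sub>1 \<delta>\<^sub>2)"
    let ?s = "norm (x - xb) + norm (y - xb)"
    have "norm (Df x - Df xb) \<le> norm (Hf xb *v (x - xb)) + norm (x - xb)"
      using d2(2)[of x] xy norm_triangle_sub[of "Df x - Df xb" "Hf xb *v (x - xb)"]
      by (simp add: dist_norm norm_minus_commute)
    also have "\<dots> \<le> (C + 1) * norm (x - xb)" using C(2)[of "x - xb"] by (simp add: algebra_simps)
    also have "\<dots> \<le> (C + 1) * ?s" using C(1) by (intro mult_left_mono) auto
    finally have *: "norm (Df x - Df xb) \<le> (C + 1) * ?s" .
    have "\<bar>(Df x - Df xb) \<bullet> (y - x)\<bar> \<le> norm (Df x - Df xb) * norm (y - x)" by (rule Cauchy_Schwarz_ineq2)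
    also have "\<dots> \<le> (C + 1) * ?s * norm (y - x)" by (intro mult_right_mono *) auto
    finally have 1: "\<bar>(Df x - Df xb) \<bullet> (y - x)\<bar> \<le> (C + 1) * ?s * norm (y - x)" .
    have "norm (y - x) \<le> ?s" using norm_triangle_ineq4[of "y - xb" "x - xb"] by simp
    then have "K * (norm (y - x))\<^sup>2 \<le> K * (norm (y - x) * ?s)"
      unfolding power2_eq_square using K(1) by (intro mult_left_mono) auto
    moreover have "\<bar>f y - f x - Df x \<bullet> (y - x)\<bar> \<le> K * (norm (y - x))\<^sup>2" using xy by (intro K(3)) auto
    ultimately have 2: "\<bar>f y - f x - Df x \<bullet> (y - x)\<bar> \<le> K * (norm (y - x) * ?s)" by linarith
    have "\<bar>f y - f x - Df xb \<bullet> (y - x)\<bar> \<le> K * (norm (y - x) * ?s) + (C + 1) * ?s * norm (y - x)"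
      using 1 2 by (simp add: inner_diff_left)
    also have "\<dots> = (K + C + 1) * norm (y - x) * ?s" by (simp add: algebra_simps)
    finally show "\<bar>f y - f x - Df xb \<bullet> (y - x)\<bar> \<le> (K + C + 1) * norm (y - x) * ?s" .
  qed (use K C d2 in auto)
qed

text \<open>The uniform Taylor estimate applies with the moving base point \<open>x t\<close>; after
  division by \<open>t ^ (2 * n)\<close> its error is at most \<epsilon> times the squared norm of
  the scaled step, which stays bounded.\<close>

lemma C2_second_difference_tendsto:
  assumes C2: "C2_on f Df Hf U" and xb: "xb \<in> U"
    and x: "(x \<longlongrightarrow> xb) (at_right (0::real))" and y: "(y \<longlongrightarrow> xb) (at_right 0)"
    and w: "((\<lambda>t. inverse (t ^ n) *\<^sub>R (y t - x t)) \<longlongrightarrow> u) (at_right 0)"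
  shows "((\<lambda>t. inverse (t ^ (2 * n)) * (f (y t) - f (x t) - Df (x t) \<bullet> (y t - x t)))
            \<longlongrightarrow> (u \<bullet> (Hf xb *v u)) / 2) (at_right 0)"
proof -
  define w where "w t = inverse (t ^ n) *\<^sub>R (y t - x t)" for t
  have wu: "(w \<longlongrightarrow> u) (at_right 0)" using assms(5) unfolding w_def .
  let ?F = "\<lambda>t. inverse (t ^ (2 * n)) * (f (y t) - f (x t) - Df (x t) \<bullet> (y t - x t))"
  let ?Q = "\<lambda>t. (w t \<bullet> (Hf xb *v w t)) / 2"
  have "((\<lambda>t. ?F t - ?Q t) \<longlongrightarrow> 0) (at_right 0)"
  proof (rule tendstoI)
    fix e :: real assume "e > 0"
    define \<epsilon> where "\<epsilon> = e / ((norm u)\<^sup>2 + 1)"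
    have pos: "(norm u)\<^sup>2 + 1 > 0" by (simp add: add_nonneg_pos)
    then have "\<epsilon> > 0" using \<open>e > 0\<close> by (simp add: \<epsilon>_def)
    then obtain \<delta> where d: "\<delta> > 0"
      "\<And>x y. x \<in> ball xb \<delta> \<Longrightarrow> y \<in> ball xb \<delta> \<Longrightarrow>
      \<bar>f y - f x - Df x \<bullet> (y - x) - ((y - x) \<bullet> (Hf xb *v (y - x))) / 2\<bar> \<le> \<epsilon> * (norm (y - x))\<^sup>2"
      using C2_taylor[OF C2 xb] by metis
    have "((\<lambda>t. (norm (w t))\<^sup>2) \<longlongrightarrow> (norm u)\<^sup>2) (at_right 0)" by (intro tendsto_intros wu)
    then have "\<forall>\<^sub>F t in at_right 0. (norm (w t))\<^sup>2 < (norm u)\<^sup>2 + 1" by (rule order_tendstoD) simp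
    then show "\<forall>\<^sub>F t in at_right 0. dist (?F t - ?Q t) 0 < e"
      using tendstoD[OF x d(1)] tendstoD[OF y d(1)] eventually_pos_less[of 1, simplified]
    proof eventually_elim
      case (elim t)
      let ?h = "y t - x t"
      let ?R = "f (y t) - f (x t) - Df (x t) \<bullet> ?h - (?h \<bullet> (Hf xb *v ?h)) / 2"
      have R: "\<bar>?R\<bar> \<le> \<epsilon> * (norm ?h)\<^sup>2" using elim by (intro d(2)) (auto simp: dist_commute)
      have Q: "?Q t = inverse (t ^ (2 * n)) * ((?h \<bullet> (Hf xb *v ?h)) / 2)"
        by (simp add: w_def matrix_vector_mult_scaleR power_mult power2_eq_square power_mult_distrib
            mult_2 power_add)
      have N: "(norm (w t))\<^sup>2 = inverse (t ^ (2 * n)) * (norm ?h)\<^sup>2"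
        using elim by (simp add: w_def power_mult_distrib mult_2 power_add power2_eq_square)
      have "\<bar>?F t - ?Q t\<bar> = inverse (t ^ (2 * n)) * \<bar>?R\<bar>"
        using elim unfolding Q right_diff_distrib[symmetric] by (simp add: abs_mult)
      also have "\<dots> \<le> inverse (t ^ (2 * n)) * (\<epsilon> * (norm ?h)\<^sup>2)"
        using elim R by (intro mult_left_mono) auto
      also have "\<dots> = \<epsilon> * (norm (w t))\<^sup>2" by (simp add: N)
      also have "\<dots> < \<epsilon> * ((norm u)\<^sup>2 + 1)" using elim \<open>\<epsilon> > 0\<close> by (intro mult_strict_left_mono) auto
      also have "\<dots> = e" using pos by (simp add: \<epsilon>_def)
      finally show ?case by (simp add: dist_real_def)
    qed
  qed
  moreover have "(?Q \<longlongrightarrow> (u \<bullet> (Hf xb *v u)) / 2) (at_right 0)"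
    by (intro tendsto_intros wu bounded_linear.tendsto[OF matrix_vector_mul_bounded_linear]) simp
  ultimately have "((\<lambda>t. (?F t - ?Q t) + ?Q t) \<longlongrightarrow> 0 + (u \<bullet> (Hf xb *v u)) / 2) (at_right 0)"
    by (rule tendsto_add)
  then show ?thesis by simp
qed

text \<open>Constants add and radii take a minimum over a finite index type. Through the l1 bound on
  the Euclidean norm this lifts the scalar estimates to vector-valued maps.\<close>

lemma finite_family_bound:
  fixes r :: "'m::finite \<Rightarrow> 'a::metric_space \<Rightarrow> 'a \<Rightarrow> real"
  assumes bd: "\<And>i. \<exists>K>0. \<exists>\<delta>>0. \<forall>x\<in>ball xb \<delta>. \<forall>y\<in>ball xb \<delta>. \<bar>r i x y\<bar> \<le> K * s x y"
  shows "\<exists>K>0. \<exists>\<delta>>0. \<forall>x\<in>ball xb \<delta>. \<forall>y\<in>ball xb \<delta>. (\<Sum>i\<in>UNIV. \<bar>r i x y\<bar>) \<le> K * s x y"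
proof -
  obtain K where K: "\<And>i. K i > 0" "\<And>i. \<exists>\<delta>>0. \<forall>x\<in>ball xb \<delta>. \<forall>y\<in>ball xb \<delta>. \<bar>r i x y\<bar> \<le> K i * s x y"
    using bd by metis
  then obtain \<delta> where d: "\<And>i. \<delta> i > 0"
    "\<And>i. \<forall>x\<in>ball xb (\<delta> i). \<forall>y\<in>ball xb (\<delta> i). \<bar>r i x y\<bar> \<le> K i * s x y"
    by metis
  have "(\<Sum>i\<in>UNIV. \<bar>r i x y\<bar>) \<le> (\<Sum>i\<in>UNIV. K i) * s x y"
    if "x \<in> ball xb (Min (range \<delta>))" "y \<in> ball xb (Min (range \<delta>))" for x y
    unfolding sum_distrib_right
  proof (rule sum_mono)
    fix i show "\<bar>r i x y\<bar> \<le> K i * s x y"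
      using that d(2)[of i] by (auto simp: Min_gr_iff)
  qed
  moreover have "(\<Sum>i\<in>UNIV. K i) > 0" using K(1) by (intro sum_pos) auto
  moreover have "Min (range \<delta>) > 0" using d(1) by (auto simp: Min_gr_iff)
  ultimately show ?thesis by blast
qed

lemma C2_taylor_first_vec:
  fixes g :: "real^'n \<Rightarrow> real^'m"
  assumes C2: "\<forall>i. C2_on (\<lambda>x. g x $ i) (\<lambda>x. Dg x $ i) (\<lambda>x. Hg x i) U" and xb: "xb \<in> U"
  obtains K \<delta> where "K > 0" "\<delta> > 0"
    "\<And>x y. x \<in> ball xb \<delta> \<Longrightarrow> y \<in> ball xb \<delta> \<Longrightarrow> norm (g y - g x - Dg x *v (y - x)) \<le> K * (norm (y - x))\<^sup>2"
proof -
  have "\<exists>K>0. \<exists>\<delta>>0. \<forall>x\<in>ball xb \<delta>. \<forall>y\<in>ball xb \<delta>.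
      (\<Sum>i\<in>UNIV. \<bar>g y $ i - g x $ i - Dg x $ i \<bullet> (y - x)\<bar>) \<le> K * (norm (y - x))\<^sup>2"
  proof (rule finite_family_bound)
    fix i
    show "\<exists>K>0. \<exists>\<delta>>0. \<forall>x\<in>ball xb \<delta>. \<forall>y\<in>ball xb \<delta>.
      \<bar>g y $ i - g x $ i - Dg x $ i \<bullet> (y - x)\<bar> \<le> K * (norm (y - x))\<^sup>2"
      using C2_taylor_first[OF C2[rule_format, of i] xb] by metis
  qed
  then obtain K \<delta> where K: "K > 0" "\<delta> > 0"
    "\<And>x y. x \<in> ball xb \<delta> \<Longrightarrow> y \<in> ball xb \<delta> \<Longrightarrow>
      (\<Sum>i\<in>UNIV. \<bar>g y $ i - g x $ i - Dg x $ i \<bullet> (y - x)\<bar>) \<le> K * (norm (y - x))\<^sup>2"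
    by blast
  have "norm (g y - g x - Dg x *v (y - x)) \<le> K * (norm (y - x))\<^sup>2"
    if "x \<in> ball xb \<delta>" "y \<in> ball xb \<delta>" for x y
    using norm_le_l1_cart[of "g y - g x - Dg x *v (y - x)"] K(3)[OF that]
    by (simp add: matrix_vector_mul_component)
  with K show ?thesis using that by blast
qed

lemma C2_strict_differentiable_vec:
  fixes g :: "real^'n \<Rightarrow> real^'m"
  assumes C2: "\<forall>i. C2_on (\<lambda>x. g x $ i) (\<lambda>x. Dg x $ i) (\<lambda>x. Hg x i) U" and xb: "xb \<in> U"
  obtains K \<delta> where "K > 0" "\<delta> > 0"
    "\<And>x y. x \<in> ball xb \<delta> \<Longrightarrow> y \<in> ball xb \<delta> \<Longrightarrow>
      norm (g y - g x - Dg xb *v (y - x)) \<le> K * (norm (y - x) * (norm (x - xb) + norm (y - xb)))"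
proof -
  have "\<exists>K>0. \<exists>\<delta>>0. \<forall>x\<in>ball xb \<delta>. \<forall>y\<in>ball xb \<delta>.
      (\<Sum>i\<in>UNIV. \<bar>g y $ i - g x $ i - Dg xb $ i \<bullet> (y - x)\<bar>) \<le> K * (norm (y - x) * (norm (x - xb) + norm (y - xb)))"
  proof (rule finite_family_bound)
    fix i
    show "\<exists>K>0. \<exists>\<delta>>0. \<forall>x\<in>ball xb \<delta>. \<forall>y\<in>ball xb \<delta>.
      \<bar>g y $ i - g x $ i - Dg xb $ i \<bullet> (y - x)\<bar> \<le> K * (norm (y - x) * (norm (x - xb) + norm (y - xb)))"
      using C2_strict_differentiable[OF C2[rule_format, of i] xb] unfolding mult.assoc by metis
  qed
  then obtain K \<delta> where K: "K > 0" "\<delta> > 0"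
    "\<And>x y. x \<in> ball xb \<delta> \<Longrightarrow> y \<in> ball xb \<delta> \<Longrightarrow>
      (\<Sum>i\<in>UNIV. \<bar>g y $ i - g x $ i - Dg xb $ i \<bullet> (y - x)\<bar>) \<le> K * (norm (y - x) * (norm (x - xb) + norm (y - xb)))"
    by blast
  have "norm (g y - g x - Dg xb *v (y - x)) \<le> K * (norm (y - x) * (norm (x - xb) + norm (y - xb)))"
    if "x \<in> ball xb \<delta>" "y \<in> ball xb \<delta>" for x y
    using norm_le_l1_cart[of "g y - g x - Dg xb *v (y - x)"] K(3)[OF that]
    by (simp add: matrix_vector_mul_component)
  with K show ?thesis using that by blast
qed

subsection \<open>The Lorentz form and the second-order cone\<close>

text \<open>\<open>lorentz p q\<close> pairs the reflection \<open>(- fst p, snd p)\<close> with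
  \<open>q\<close>. The cone consists of the \<open>p\<close> with
  \<open>lorentz p p \<le> 0\<close> and \<open>fst p \<ge> 0\<close>, its boundary of the null
  vectors among them, so lying on the boundary becomes a polynomial equation.\<close>

definition lorentz :: "real \<times> 'b::euclidean_space \<Rightarrow> real \<times> 'b \<Rightarrow> real" where
  "lorentz p q = snd p \<bullet> snd q - fst p * fst q"

lemma bounded_bilinear_lorentz: "bounded_bilinear (lorentz :: real \<times> 'b::euclidean_space \<Rightarrow> _)"
  unfolding bilinear_conv_bounded_bilinear[symmetric] bilinear_def
  by (auto intro!: linearI simp: lorentz_def algebra_simps)

interpretation lorentz: bounded_bilinear lorentz
  by (rule bounded_bilinear_lorentz)

lemma lorentz_commute: "lorentz p q = lorentz q p"
  by (simp add: lorentz_def inner_commute mult.commute)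

lemma lorentz_add_self: "lorentz (p + q) (p + q) = lorentz p p + 2 * lorentz p q + lorentz q q"
  by (simp add: lorentz.add_left lorentz.add_right lorentz_commute[of q p])

lemma in_SOC_iff: "p \<in> SOC \<longleftrightarrow> norm (snd p) \<le> fst p"
  by (cases p) (simp add: SOC_def)

text \<open>By Cauchy-Schwarz the reflection of a cone element lies in the polar cone; this gives
  the multipliers below their sign.\<close>

lemma lorentz_SOC_nonpos:
  assumes "p \<in> SOC" "q \<in> SOC"
  shows "lorentz p q \<le> 0"
proof -
  have "snd p \<bullet> snd q \<le> norm (snd p) * norm (snd q)" by (rule norm_cauchy_schwarz)
  also have "\<dots> \<le> fst p * fst q"
    using assms by (intro mult_mono) (auto simp: in_SOC_iff intro: order_trans[OF norm_ge_zero])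
  finally show ?thesis by (simp add: lorentz_def)
qed

lemma lorentz_self_zero_imp_SOC:
  assumes "lorentz p p = 0" "fst p > 0"
  shows "p \<in> SOC"
proof -
  have "(norm (snd p))\<^sup>2 = (fst p)\<^sup>2" using assms(1) by (simp add: lorentz_def dot_square_norm power2_eq_square)
  then have "norm (snd p) = fst p" using assms(2) by (simp add: power2_eq_iff_nonneg)
  then show ?thesis by (simp add: in_SOC_iff)
qed

text \<open>Raising the first component of \<open>p\<close> until it equals
  \<open>norm (snd p)\<close> lands in the cone.\<close>

lemma infdist_SOC_le: "infdist p SOC \<le> max 0 (norm (snd p) - fst p)"
proof (cases "p \<in> SOC")
  case False
  have "infdist p SOC \<le> dist p (norm (snd p), snd p)"
    by (rule infdist_le) (simp add: in_SOC_iff)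
  also have "\<dots> = norm (snd p) - fst p"
    using False by (cases p) (simp add: in_SOC_iff dist_Pair_Pair dist_real_def)
  finally show ?thesis by simp
qed simp

text \<open>The inequality
  \<open>2 * fst q * norm a \<le> (norm a)\<^sup>2 + (fst q)\<^sup>2\<close> replaces the norm by a
  quadratic, so no square root is expanded and the first-order term is exactly the Lorentz
  form.\<close>

lemma SOC_gap_le:
  assumes "q \<in> SOC" "fst q > 0"
  shows "norm (snd q + t *\<^sub>R snd p) - (fst q + t * fst p)
           \<le> t * (lorentz q p / fst q) + t\<^sup>2 * ((norm (snd p))\<^sup>2 / (2 * fst q))"
proof -
  let ?a = "snd q + t *\<^sub>R snd p"
  have "0 \<le> (norm ?a - fst q)\<^sup>2" by simp
  then have "2 * fst q * norm ?a \<le> (norm ?a)\<^sup>2 + (fst q)\<^sup>2" by (simp add: power2_eq_square algebra_simps)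
  also have "(norm ?a)\<^sup>2 = (norm (snd q))\<^sup>2 + 2 * t * (snd q \<bullet> snd p) + t\<^sup>2 * (norm (snd p))\<^sup>2"
    unfolding power2_norm_eq_inner by (simp add: power2_eq_square algebra_simps inner_commute)
  also have "(norm (snd q))\<^sup>2 \<le> (fst q)\<^sup>2" using assms by (simp add: in_SOC_iff power_mono)
  finally have "norm ?a \<le> (2 * (fst q)\<^sup>2 + 2 * t * (snd q \<bullet> snd p) + t\<^sup>2 * (norm (snd p))\<^sup>2) / (2 * fst q)"
    using assms by (simp add: field_simps)
  also have "\<dots> = fst q + t * fst p + t * (lorentz q p / fst q) + t\<^sup>2 * ((norm (snd p))\<^sup>2 / (2 * fst q))"
    using assms by (simp add: lorentz_def field_simps power2_eq_square)
  finally show ?thesis by simp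
qed

text \<open>The equality case of Cauchy-Schwarz: with \<open>c\<close> the ratio of the first
  components, the three conditions make \<open>(norm (snd p - c snd q))\<^sup>2\<close>
  vanish.\<close>

lemma lorentz_null_parallel:
  assumes "lorentz q q = 0" "lorentz q p = 0" "lorentz p p = 0" "fst q > 0"
  shows "p = (fst p / fst q) *\<^sub>R q"
proof -
  let ?c = "fst p / fst q"
  have "(norm (snd p - ?c *\<^sub>R snd q))\<^sup>2 = snd p \<bullet> snd p - 2 * ?c * (snd q \<bullet> snd p) + ?c\<^sup>2 * (snd q \<bullet> snd q)"
    unfolding power2_norm_eq_inner by (simp add: power2_eq_square algebra_simps inner_commute)
  also have "\<dots> = fst p * fst p - 2 * ?c * (fst q * fst p) + ?c\<^sup>2 * (fst q * fst q)"
    using assms by (simp add: lorentz_def)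
  also have "\<dots> = 0" using assms(4) by (simp add: power2_eq_square field_simps)
  finally have "snd p = ?c *\<^sub>R snd q" by simp
  then show ?thesis using assms(4) by (simp add: prod_eq_iff)
qed

text \<open>The hypothesis is a penalized form of \<open>e \<bullet> u \<le> 0 \<Longrightarrow> a
  \<bullet> u \<ge> 0\<close>. Testing with minus the component of \<open>a\<close> orthogonal to
  \<open>e\<close> shows that \<open>a\<close> is a multiple of \<open>e\<close>; testing with
  \<open>- e\<close> fixes the sign. For \<open>e = 0\<close> both sides are 0.\<close>

lemma one_sided_farkas:
  fixes a e :: "'a::real_inner"
  assumes ineq: "\<And>u. a \<bullet> u + C * max 0 (e \<bullet> u) \<ge> 0"
  shows "a = - (norm a / norm e) *\<^sub>R e"
proof (cases "e = 0")
  case True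
  with ineq[of "- a"] have "a \<bullet> a \<le> 0" by simp
  then have "a = 0" using inner_ge_zero[of a] by (metis antisym inner_eq_zero_iff)
  with True show ?thesis by simp
next
  case False
  define w where "w = a - ((a \<bullet> e) / (e \<bullet> e)) *\<^sub>R e"
  have ew: "e \<bullet> w = 0" using False by (simp add: w_def inner_diff_right inner_commute)
  have "a \<bullet> w = w \<bullet> w" using ew by (simp add: w_def inner_diff_left inner_diff_right inner_commute)
  with ineq[of "- w"] ew have "w \<bullet> w \<le> 0" by simp
  then have "w = 0" using inner_ge_zero[of w] by (metis antisym inner_eq_zero_iff)
  then have a: "a = ((a \<bullet> e) / (e \<bullet> e)) *\<^sub>R e" by (simp add: w_def)
  have le: "a \<bullet> e \<le> 0" using ineq[of "- e"] by (simp add: max_absorb1)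
  have "norm a = \<bar>a \<bullet> e\<bar> / (e \<bullet> e) * norm e" by (subst a) simp
  then have "norm a / norm e = - (a \<bullet> e) / (e \<bullet> e)" using False le by simp
  then show ?thesis using a by simp
qed

subsection \<open>Second-order cone programs\<close>

text \<open>The data and hypotheses that involve neither the modulus \<kappa> nor the direction
  \<open>ub\<close>. Leaving \<kappa> out allows the second-order bound to be used for a whole range
  of moduli when the exact bound is estimated.\<close>

locale soc_program =
  fixes f :: "real^'n \<Rightarrow> real" and Df :: "real^'n \<Rightarrow> real^'n" and Hf :: "real^'n \<Rightarrow> real^'n^'n"
    and g0 :: "real^'n \<Rightarrow> real" and Dg0 :: "real^'n \<Rightarrow> real^'n" and Hg0 :: "real^'n \<Rightarrow> real^'n^'n"
    and gr :: "real^'n \<Rightarrow> real^'m" and Dgr :: "real^'n \<Rightarrow> real^'n^'m"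
    and Hgr :: "real^'n \<Rightarrow> 'm \<Rightarrow> real^'n^'n"
    and xb :: "real^'n" and \<sigma> :: real and U :: "(real^'n) set"
  assumes xbU: "xb \<in> U"
    and C2f: "C2_on f Df Hf U"
    and C2g0: "C2_on g0 Dg0 Hg0 U"
    and C2gr: "\<forall>i. C2_on (\<lambda>x. gr x $ i) (\<lambda>x. Dgr x $ i) (\<lambda>x. Hgr x i) U"
    and gxb: "g0 xb = 0" "gr xb = 0"
    and sigma: "\<sigma> > 0"
    and MSCQ: "\<exists>W. open W \<and> xb \<in> W \<and>
      (\<forall>x\<in>W. infdist x {x. (g0 x, gr x) \<in> SOC} \<le> \<sigma> * infdist (g0 x, gr x) SOC)"
begin

section \<open>The constraint map and its linearization at \<open>xb\<close>\<close>

definition G :: "real^'n \<Rightarrow> real \<times> (real^'m)" where "G x = (g0 x, gr x)"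

definition lin :: "real^'n \<Rightarrow> real \<times> (real^'m)" where "lin u = (Dg0 xb \<bullet> u, Dgr xb *v u)"

definition feas :: "(real^'n) set" where "feas = {x. (g0 x, gr x) \<in> SOC}"

lemma feas_iff: "x \<in> feas \<longleftrightarrow> G x \<in> SOC"
  by (simp add: feas_def G_def)

lemma G_xb: "G xb = 0"
  by (simp add: G_def gxb zero_prod_def)

lemma xb_feas: "xb \<in> feas"
  by (simp add: feas_iff G_xb in_SOC_iff)

lemma bounded_linear_lin: "bounded_linear lin"
  unfolding lin_def
  by (intro bounded_linear_Pair bounded_linear_inner_right matrix_vector_mul_bounded_linear)

sublocale lin: bounded_linear lin
  by (rule bounded_linear_lin)

lemma G_strict:
  obtains K \<delta> where "K > 0" "\<delta> > 0"
    "\<And>x y. x \<in> ball xb \<delta> \<Longrightarrow> y \<in> ball xb \<delta> \<Longrightarrow>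
      norm (G y - G x - lin (y - x)) \<le> K * (norm (y - x) * (norm (x - xb) + norm (y - xb)))"
proof -
  obtain K1 d1 where 1: "K1 > 0" "d1 > 0"
    "\<And>x y. x \<in> ball xb d1 \<Longrightarrow> y \<in> ball xb d1 \<Longrightarrow>
      \<bar>g0 y - g0 x - Dg0 xb \<bullet> (y - x)\<bar> \<le> K1 * norm (y - x) * (norm (x - xb) + norm (y - xb))"
    using C2_strict_differentiable[OF C2g0 xbU] by blast
  obtain K2 d2 where 2: "K2 > 0" "d2 > 0"
    "\<And>x y. x \<in> ball xb d2 \<Longrightarrow> y \<in> ball xb d2 \<Longrightarrow>
      norm (gr y - gr x - Dgr xb *v (y - x)) \<le> K2 * (norm (y - x) * (norm (x - xb) + norm (y - xb)))"
    using C2_strict_differentiable_vec[OF C2gr xbU] by blast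
  show ?thesis
  proof (rule that[of "K1 + K2" "min d1 d2"])
    fix x y assume xy: "x \<in> ball xb (min d1 d2)" "y \<in> ball xb (min d1 d2)"
    have "norm (G y - G x - lin (y - x)) \<le> \<bar>g0 y - g0 x - Dg0 xb \<bullet> (y - x)\<bar> + norm (gr y - gr x - Dgr xb *v (y - x))"
      using norm_Pair_le[of "g0 y - g0 x - Dg0 xb \<bullet> (y - x)" "gr y - gr x - Dgr xb *v (y - x)"]
      by (simp add: G_def lin_def)
    with 1(3)[of x y] 2(3)[of x y] xy
    show "norm (G y - G x - lin (y - x)) \<le> (K1 + K2) * (norm (y - x) * (norm (x - xb) + norm (y - xb)))"
      by (simp add: distrib_right mult.assoc)
  qed (use 1 2 in auto)
qed

text \<open>By \<open>G_strict\<close> the linearization error is bounded by the step times the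
  distances to \<open>xb\<close>, so the orders add. The successor in \<open>Suc m\<close>
  guarantees that both curves tend to \<open>xb\<close>.\<close>

lemma vanish_order_G_diff:
  assumes "vanish_order (Suc m) (\<lambda>t. x t - xb)" "vanish_order (Suc m) (\<lambda>t. y t - xb)" "vanish_order n (\<lambda>t. y t - x t)"
  shows "vanish_order (Suc m + n) (\<lambda>t. G (y t) - G (x t) - lin (y t - x t))"
proof -
  obtain K \<delta> where K: "K > 0" "\<delta> > 0"
    "\<And>x y. x \<in> ball xb \<delta> \<Longrightarrow> y \<in> ball xb \<delta> \<Longrightarrow>
      norm (G y - G x - lin (y - x)) \<le> K * (norm (y - x) * (norm (x - xb) + norm (y - xb)))"
    using G_strict by blast
  have nrm: "vanish_order k (\<lambda>t. norm (r t))" if "vanish_order k r" for k and r :: "real \<Rightarrow> real^'n"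
    using that by (rule vanish_order_bound) simp
  have "vanish_order (Suc m + n) (\<lambda>t. (norm (x t - xb) + norm (y t - xb)) * norm (y t - x t))"
    using assms by (intro vanish_order_bilinear[OF bounded_bilinear_mult] vanish_order_add nrm)
  then have "vanish_order (Suc m + n) (\<lambda>t. K * ((norm (x t - xb) + norm (y t - xb)) * norm (y t - x t)))"
    by (rule vanish_order_linear[OF bounded_linear_mult_right])
  then show ?thesis
  proof (rule vanish_order_bound)
    show "\<forall>\<^sub>F t in at_right 0. norm (G (y t) - G (x t) - lin (y t - x t))
        \<le> norm (K * ((norm (x t - xb) + norm (y t - xb)) * norm (y t - x t)))"
      using tendstoD[OF vanish_order_tendsto_zero[OF assms(1)] K(2)] tendstoD[OF vanish_order_tendsto_zero[OF assms(2)] K(2)]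
    proof eventually_elim
      case (elim t)
      then show ?case using K(1) K(3)[of "x t" "y t"]
        by (simp add: dist_norm norm_minus_commute mult.commute)
    qed
  qed
qed

section \<open>The Hessian of the Lagrangian and the second-order inequality along two feasible
  curves\<close>

definition hess :: "real \<Rightarrow> real^'m \<Rightarrow> real^'n^'n" where
  "hess l0 lr = Hf xb + l0 *\<^sub>R Hg0 xb + (\<Sum>i\<in>UNIV. (lr $ i) *\<^sub>R Hgr xb i)"

lemma inner_hess: "u \<bullet> (hess l0 lr *v u) =
  u \<bullet> (Hf xb *v u) + l0 * (u \<bullet> (Hg0 xb *v u)) + (\<Sum>i\<in>UNIV. lr $ i * (u \<bullet> (Hgr xb i *v u)))"
proof -
  interpret L: bounded_linear "\<lambda>M :: real^'n^'n. u \<bullet> (M *v u)"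
    by (intro bounded_linear_compose[OF bounded_linear_inner_right]
        bounded_bilinear.bounded_linear_left[OF bounded_bilinear_matrix_vector_mult])
  show ?thesis by (simp add: hess_def L.add L.sum L.scaleR)
qed

text \<open>By \<open>polar\<close> and \<open>compl\<close>, the Lagrangian with multiplier
  \<open>(l0 t, lr t)\<close> minorizes \<open>f\<close> on the feasible set and agrees with it at
  \<open>x t\<close>. Its quadratic lower model therefore supplies the proximal inequality that
  \<open>tilt_stable_growth\<close> needs, with one constant for all small \<open>t\<close>.
  Dividing the resulting growth between \<open>x t\<close> and \<open>y t\<close> by
  \<open>t ^ (2 * n)\<close> gives the claim in the limit; \<open>slack\<close> makes the multiplier
  term at \<open>y t\<close> negligible.\<close>

lemma second_order_bound:
  assumes tilt: "tilt_stable f feas xb \<kappa>" and kappa: "\<kappa> > 0"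
    and feas: "\<forall>\<^sub>F t in at_right 0. x t \<in> feas" "\<forall>\<^sub>F t in at_right 0. y t \<in> feas"
    and x: "vanish_order 1 (\<lambda>t. x t - xb)" and n: "n \<ge> 1"
    and y: "vanish_order (Suc n) (\<lambda>t. y t - x t - t ^ n *\<^sub>R u)"
    and l0: "(l0 \<longlongrightarrow> L0) (at_right 0)" and lr: "(lr \<longlongrightarrow> Lr) (at_right 0)"
    and stat: "Df xb + L0 *\<^sub>R Dg0 xb + transpose (Dgr xb) *v Lr = 0"
    and polar: "\<forall>\<^sub>F t in at_right 0. \<forall>p\<in>SOC. l0 t * fst p + lr t \<bullet> snd p \<le> 0"
    and compl: "\<forall>\<^sub>F t in at_right 0. l0 t * g0 (x t) + lr t \<bullet> gr (x t) = 0"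
    and slack: "vanish_order (Suc (2 * n)) (\<lambda>t. l0 t * g0 (y t) + lr t \<bullet> gr (y t))"
  shows "u \<bullet> (hess L0 Lr *v u) \<ge> (norm u)\<^sup>2 / \<kappa>"
proof -
  \<comment> \<open>The gradient at \<open>x t\<close> of the Lagrangian with multiplier
    \<open>(l0 t, lr t)\<close>; it tends to 0 by \<open>stat\<close>.\<close>
  define v where "v t = Df (x t) + l0 t *\<^sub>R Dg0 (x t) + transpose (Dgr (x t)) *v lr t" for t
  define s where "s t = l0 t * g0 (y t) + lr t \<bullet> gr (y t)" for t
  have xlim: "(x \<longlongrightarrow> xb) (at_right 0)"
    using vanish_order_tendsto_zero[of 0 "\<lambda>t. x t - xb"] x by (simp add: LIM_zero_iff)
  have "vanish_order 1 (\<lambda>t. (y t - x t - t ^ n *\<^sub>R u) + t ^ n *\<^sub>R u + (x t - xb))"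
    using n by (intro vanish_order_add x vanish_order_power vanish_order_mono[OF y]) auto
  then have y1: "vanish_order 1 (\<lambda>t. y t - xb)" by simp
  then have ylim: "(y \<longlongrightarrow> xb) (at_right 0)"
    using vanish_order_tendsto_zero[of 0 "\<lambda>t. y t - xb"] by (simp add: LIM_zero_iff)
  have wlim: "((\<lambda>t. inverse (t ^ n) *\<^sub>R (y t - x t)) \<longlongrightarrow> u) (at_right 0)"
    by (rule vanish_order_tendsto_lim[OF y])
  have comp: "((\<lambda>t. \<phi> (x t)) \<longlongrightarrow> \<phi> xb) (at_right 0)"
    if "(\<phi> has_derivative \<phi>') (at xb)" for \<phi> :: "real^'n \<Rightarrow> real^'n" and \<phi>'
    using isCont_tendsto_compose[OF has_derivative_continuous[OF that] xlim] .
  have "(v \<longlongrightarrow> Df xb + L0 *\<^sub>R Dg0 xb + transpose (Dgr xb) *v Lr) (at_right 0)"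
    unfolding v_def
  proof (intro tendsto_intros l0 bounded_bilinear.tendsto[OF bounded_bilinear_matrix_vector_mult] lr
      bounded_linear.tendsto[OF bounded_linear_transpose])
    show "((\<lambda>t. Df (x t)) \<longlongrightarrow> Df xb) (at_right 0)" by (rule comp[OF C2_onD(2)[OF C2f xbU]])
    show "((\<lambda>t. Dg0 (x t)) \<longlongrightarrow> Dg0 xb) (at_right 0)" by (rule comp[OF C2_onD(2)[OF C2g0 xbU]])
    show "((\<lambda>t. Dgr (x t)) \<longlongrightarrow> Dgr xb) (at_right 0)"
      by (rule vec_tendstoI) (rule comp[OF C2_onD(2)[OF C2gr[rule_format] xbU]])
  qed
  then have vlim: "(v \<longlongrightarrow> 0) (at_right 0)" unfolding stat .
  have vinner: "v t \<bullet> h = Df (x t) \<bullet> h + l0 t * (Dg0 (x t) \<bullet> h) + lr t \<bullet> (Dgr (x t) *v h)" for t h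
    by (simp add: v_def inner_add_left dot_lmul_matrix)
  obtain Kf df where Kf: "Kf > 0" "df > 0"
    "\<And>x y. x \<in> ball xb df \<Longrightarrow> y \<in> ball xb df \<Longrightarrow> \<bar>f y - f x - Df x \<bullet> (y - x)\<bar> \<le> Kf * (norm (y - x))\<^sup>2"
    using C2_taylor_first[OF C2f xbU] by blast
  obtain K0 d0 where K0: "K0 > 0" "d0 > 0"
    "\<And>x y. x \<in> ball xb d0 \<Longrightarrow> y \<in> ball xb d0 \<Longrightarrow> \<bar>g0 y - g0 x - Dg0 x \<bullet> (y - x)\<bar> \<le> K0 * (norm (y - x))\<^sup>2"
    using C2_taylor_first[OF C2g0 xbU] by blast
  obtain Kr dr where Kr: "Kr > 0" "dr > 0"
    "\<And>x y. x \<in> ball xb dr \<Longrightarrow> y \<in> ball xb dr \<Longrightarrow> norm (gr y - gr x - Dgr x *v (y - x)) \<le> Kr * (norm (y - x))\<^sup>2"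
    using C2_taylor_first_vec[OF C2gr xbU] by blast
  define \<delta> where "\<delta> = min df (min d0 dr)"
  \<comment> \<open>The multipliers are eventually bounded by \<open>\<bar>L0\<bar> + 1\<close> and
    \<open>norm Lr + 1\<close>, so \<open>c\<close> does not depend on \<open>t\<close>, and neither
    does the radius \<rho> obtained from it.\<close>
  define c where "c = Kf + (\<bar>L0\<bar> + 1) * K0 + (norm Lr + 1) * Kr"
  have d: "\<delta> > 0" using Kf K0 Kr by (simp add: \<delta>_def)
  have "c \<ge> 0" using Kf K0 Kr by (simp add: c_def add_nonneg_nonneg)
  obtain \<rho> where \<rho>: "\<rho> > 0"
    "\<And>x v y. x \<in> feas \<Longrightarrow> norm (x - xb) < \<rho> \<Longrightarrow> norm v < \<rho> \<Longrightarrow>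
       (\<forall>x'\<in>feas. norm (x' - xb) < \<delta> \<longrightarrow>
           f x' \<ge> f x + v \<bullet> (x' - x) - c * (norm (x' - x))\<^sup>2) \<Longrightarrow>
       y \<in> feas \<Longrightarrow> norm (y - xb) < \<rho> \<Longrightarrow>
       f y \<ge> f x + v \<bullet> (y - x) + (norm (y - x))\<^sup>2 / (2 * \<kappa>)"
    by (rule tilt_stable_growth[OF tilt kappa \<open>c \<ge> 0\<close> d]) (rule that)
  have "((\<lambda>t. \<bar>l0 t\<bar>) \<longlongrightarrow> \<bar>L0\<bar>) (at_right 0)" "((\<lambda>t. norm (lr t)) \<longlongrightarrow> norm Lr) (at_right 0)"
    by (intro tendsto_intros l0 lr)+
  then have lbd: "\<forall>\<^sub>F t in at_right 0. \<bar>l0 t\<bar> < \<bar>L0\<bar> + 1" "\<forall>\<^sub>F t in at_right 0. norm (lr t) < norm Lr + 1"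
    by (auto intro: order_tendstoD)
  have growth: "\<forall>\<^sub>F t in at_right 0. f (y t) \<ge> f (x t) + v t \<bullet> (y t - x t) + (norm (y t - x t))\<^sup>2 / (2 * \<kappa>)"
    using feas polar compl lbd tendstoD[OF xlim \<rho>(1)] tendstoD[OF ylim \<rho>(1)] tendstoD[OF vlim \<rho>(1)]
      tendstoD[OF xlim d]
  proof eventually_elim
    case (elim t)
    show ?case
    proof (rule \<rho>(2), goal_cases)
      case 4
      show ?case
      proof (intro ballI impI)
        fix x' assume x': "x' \<in> feas" "norm (x' - xb) < \<delta>"
        let ?h = "x' - x t"
        let ?N = "(norm ?h)\<^sup>2"
        have near: "x t \<in> ball xb \<delta>" "x' \<in> ball xb \<delta>"
          using elim x' by (auto simp: dist_norm norm_minus_commute)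
        have "l0 t * fst (G x') + lr t \<bullet> snd (G x') \<le> 0" using elim x' by (auto simp: feas_iff)
        then have sgn: "l0 t * (g0 x' - g0 (x t)) + lr t \<bullet> (gr x' - gr (x t)) \<le> 0"
          using elim by (simp add: G_def algebra_simps)
        have 1: "f x' - f (x t) - Df (x t) \<bullet> ?h \<ge> - (Kf * ?N)"
          using Kf(3)[of "x t" x'] near by (auto simp: \<delta>_def)
        have "\<bar>l0 t * (g0 x' - g0 (x t) - Dg0 (x t) \<bullet> ?h)\<bar> \<le> (\<bar>L0\<bar> + 1) * (K0 * ?N)"
          unfolding abs_mult using K0(3)[of "x t" x'] near elim by (intro mult_mono) (auto simp: \<delta>_def)
        then have 2: "l0 t * (g0 x' - g0 (x t) - Dg0 (x t) \<bullet> ?h) \<ge> - ((\<bar>L0\<bar> + 1) * (K0 * ?N))" by linarith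
        have "\<bar>lr t \<bullet> (gr x' - gr (x t) - Dgr (x t) *v ?h)\<bar> \<le> norm (lr t) * norm (gr x' - gr (x t) - Dgr (x t) *v ?h)"
          by (rule Cauchy_Schwarz_ineq2)
        also have "\<dots> \<le> (norm Lr + 1) * (Kr * ?N)"
          using Kr(3)[of "x t" x'] near elim by (intro mult_mono) (auto simp: \<delta>_def)
        finally have 3: "lr t \<bullet> (gr x' - gr (x t) - Dgr (x t) *v ?h) \<ge> - ((norm Lr + 1) * (Kr * ?N))" by linarith
        have "c * ?N = Kf * ?N + (\<bar>L0\<bar> + 1) * (K0 * ?N) + (norm Lr + 1) * (Kr * ?N)"
          by (simp add: c_def algebra_simps)
        moreover have "l0 t * (g0 x' - g0 (x t) - Dg0 (x t) \<bullet> ?h) = l0 t * (g0 x' - g0 (x t)) - l0 t * (Dg0 (x t) \<bullet> ?h)"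
          "lr t \<bullet> (gr x' - gr (x t) - Dgr (x t) *v ?h) = lr t \<bullet> (gr x' - gr (x t)) - lr t \<bullet> (Dgr (x t) *v ?h)"
          by (simp_all add: right_diff_distrib inner_diff_right)
        ultimately show "f x' \<ge> f (x t) + v t \<bullet> ?h - c * ?N"
          using 1 2 3 sgn unfolding vinner by linarith
      qed
    qed (use elim in \<open>auto simp: dist_norm\<close>)
  qed
  let ?S = "\<lambda>\<phi> D\<phi> t. inverse (t ^ (2 * n)) * (\<phi> (y t) - \<phi> (x t) - D\<phi> (x t) \<bullet> (y t - x t))"
  note lims = C2_second_difference_tendsto[OF _ xbU xlim ylim wlim]
  \<comment> \<open>The scaled second-order remainder of the Lagrangian, minus the scaled multiplier
    term at \<open>y t\<close>. As \<open>compl\<close> removes that term at \<open>x t\<close>,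
    this is \<open>f (y t) - f (x t) - v t \<bullet> (y t - x t)\<close> divided by
    \<open>t ^ (2 * n)\<close>.\<close>
  let ?R = "\<lambda>t. ?S f Df t + l0 t * ?S g0 Dg0 t + (\<Sum>i\<in>UNIV. lr t $ i * ?S (\<lambda>x. gr x $ i) (\<lambda>x. Dgr x $ i) t)
      - inverse (t ^ (2 * n)) *\<^sub>R s t"
  have "(?R \<longlongrightarrow> (u \<bullet> (Hf xb *v u)) / 2 + L0 * ((u \<bullet> (Hg0 xb *v u)) / 2)
      + (\<Sum>i\<in>UNIV. Lr $ i * ((u \<bullet> (Hgr xb i *v u)) / 2)) - 0) (at_right 0)"
    by (intro tendsto_intros lims[OF C2f] lims[OF C2g0] lims[OF C2gr[rule_format]] l0 lr)
       (use vanish_order_tendsto[OF slack] in \<open>simp add: s_def\<close>)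
  moreover have "(u \<bullet> (Hf xb *v u)) / 2 + L0 * ((u \<bullet> (Hg0 xb *v u)) / 2)
      + (\<Sum>i\<in>UNIV. Lr $ i * ((u \<bullet> (Hgr xb i *v u)) / 2)) - 0 = (u \<bullet> (hess L0 Lr *v u)) / 2"
    by (simp add: inner_hess add_divide_distrib sum_divide_distrib)
  ultimately have R: "(?R \<longlongrightarrow> (u \<bullet> (hess L0 Lr *v u)) / 2) (at_right 0)" by (simp only:)
  have L: "((\<lambda>t. (norm (inverse (t ^ n) *\<^sub>R (y t - x t)))\<^sup>2 / (2 * \<kappa>)) \<longlongrightarrow> (norm u)\<^sup>2 / (2 * \<kappa>)) (at_right 0)"
    using kappa by (intro tendsto_intros wlim) auto
  have distr: "k * (a + l * b + (\<Sum>i\<in>UNIV. r i * c i) - e) = k * a + l * (k * b) + (\<Sum>i\<in>UNIV. r i * (k * c i)) - k * e"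
    for k a l b e :: real and r c :: "'m \<Rightarrow> real"
    by (simp add: algebra_simps sum_distrib_left)
  have "\<forall>\<^sub>F t in at_right 0. (norm (inverse (t ^ n) *\<^sub>R (y t - x t)))\<^sup>2 / (2 * \<kappa>) \<le> ?R t"
    using growth compl eventually_pos_less[of 1, simplified]
  proof eventually_elim
    case (elim t)
    let ?h = "y t - x t"
    have "(norm (inverse (t ^ n) *\<^sub>R ?h))\<^sup>2 = inverse (t ^ (2 * n)) * (norm ?h)\<^sup>2"
      using elim(3) by (simp add: power_mult_distrib mult_2 power_add power2_eq_square)
    then have "(norm (inverse (t ^ n) *\<^sub>R ?h))\<^sup>2 / (2 * \<kappa>) = inverse (t ^ (2 * n)) * ((norm ?h)\<^sup>2 / (2 * \<kappa>))"
      by simp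
    also have "\<dots> \<le> inverse (t ^ (2 * n)) * (f (y t) - f (x t) - v t \<bullet> ?h)"
    proof (rule mult_left_mono)
      show "(norm ?h)\<^sup>2 / (2 * \<kappa>) \<le> f (y t) - f (x t) - v t \<bullet> ?h" using elim(1) by linarith
    qed (use elim(3) in auto)
    also have "f (y t) - f (x t) - v t \<bullet> ?h = (f (y t) - f (x t) - Df (x t) \<bullet> ?h)
       + l0 t * (g0 (y t) - g0 (x t) - Dg0 (x t) \<bullet> ?h)
       + lr t \<bullet> (gr (y t) - gr (x t) - Dgr (x t) *v ?h) - s t"
      using elim(2) by (simp add: vinner s_def inner_diff_right[of "lr t"] right_diff_distrib[of "l0 t"])
    also have "lr t \<bullet> (gr (y t) - gr (x t) - Dgr (x t) *v ?h)
        = (\<Sum>i\<in>UNIV. lr t $ i * (gr (y t) $ i - gr (x t) $ i - Dgr (x t) $ i \<bullet> ?h))"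
      by (simp add: inner_vec_def[of "lr t"] matrix_vector_mul_component)
    finally show ?case unfolding real_scaleR_def distr .
  qed
  then have "(norm u)\<^sup>2 / (2 * \<kappa>) \<le> (u \<bullet> (hess L0 Lr *v u)) / 2"
    by (intro tendsto_le[OF _ R L]) auto
  then show ?thesis using kappa by (simp add: field_simps)
qed

section \<open>Tangent directions, feasible curves and first-order conditions\<close>

text \<open>The values of \<open>G\<close> along the tangent sequence, divided by
  \<open>t k\<close>, stay in the cone and tend to \<open>lin ub\<close>; the cone is
  closed.\<close>

lemma tangent_imp_lin_SOC:
  assumes "ub \<in> tangent_cone feas xb"
  shows "lin ub \<in> SOC"
proof -
  obtain t v where tv: "\<And>k. t k > 0" "\<And>k. xb + t k *\<^sub>R v k \<in> feas" "t \<longlonglongrightarrow> 0" "v \<longlonglongrightarrow> ub"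
    using assms unfolding tangent_cone_def by blast
  obtain K \<delta> where K: "K > 0" "\<delta> > 0"
    "\<And>x y. x \<in> ball xb \<delta> \<Longrightarrow> y \<in> ball xb \<delta> \<Longrightarrow>
      norm (G y - G x - lin (y - x)) \<le> K * (norm (y - x) * (norm (x - xb) + norm (y - xb)))"
    using G_strict by blast
  have tv0: "(\<lambda>k. t k *\<^sub>R v k) \<longlonglongrightarrow> 0" using tendsto_scaleR[OF tv(3,4)] by simp
  define r where "r k = inverse (t k) *\<^sub>R G (xb + t k *\<^sub>R v k) - lin (v k)" for k
  have "\<forall>\<^sub>F k in sequentially. norm (r k) \<le> K * (t k * (norm (v k))\<^sup>2)"
    using tendstoD[OF tv0 K(2)]
  proof eventually_elim
    case (elim k)
    have "norm (G (xb + t k *\<^sub>R v k) - t k *\<^sub>R lin (v k)) \<le> K * (norm (t k *\<^sub>R v k) * norm (t k *\<^sub>R v k))"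
      using K(3)[of xb "xb + t k *\<^sub>R v k"] K(2) elim by (simp add: G_xb lin.scaleR dist_norm)
    also have "\<dots> = K * (t k * t k * (norm (v k))\<^sup>2)"
      using tv(1)[of k] by (simp add: power2_eq_square)
    finally have "inverse (t k) * norm (G (xb + t k *\<^sub>R v k) - t k *\<^sub>R lin (v k))
        \<le> inverse (t k) * (K * (t k * t k * (norm (v k))\<^sup>2))"
      using tv(1)[of k] by (intro mult_left_mono) auto
    moreover have "r k = inverse (t k) *\<^sub>R (G (xb + t k *\<^sub>R v k) - t k *\<^sub>R lin (v k))"
      using tv(1)[of k] by (simp add: r_def scaleR_diff_right)
    moreover have "inverse (t k) * (K * (t k * t k * (norm (v k))\<^sup>2)) = K * (t k * (norm (v k))\<^sup>2)"
      using tv(1)[of k] by simp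
    ultimately show ?case using tv(1)[of k] by (simp only: norm_scaleR abs_inverse abs_of_pos)
  qed
  moreover have "(\<lambda>k. K * (t k * (norm (v k))\<^sup>2)) \<longlonglongrightarrow> K * (0 * (norm ub)\<^sup>2)"
    by (intro tendsto_intros tv)
  ultimately have "r \<longlonglongrightarrow> 0" using Lim_null_comparison by fastforce
  then have "(\<lambda>k. r k + lin (v k)) \<longlonglongrightarrow> 0 + lin ub"
    by (intro tendsto_add lin.tendsto tv)
  then have lim: "(\<lambda>k. inverse (t k) *\<^sub>R G (xb + t k *\<^sub>R v k)) \<longlonglongrightarrow> lin ub" by (simp add: r_def)
  have "norm (snd (lin ub)) \<le> fst (lin ub)"
  proof (rule LIMSEQ_le[OF tendsto_norm[OF tendsto_snd[OF lim]] tendsto_fst[OF lim]], intro exI allI impI)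
    fix k
    have "norm (snd (G (xb + t k *\<^sub>R v k))) \<le> fst (G (xb + t k *\<^sub>R v k))"
      using tv(2)[of k] by (simp add: feas_iff in_SOC_iff)
    then show "norm (snd (inverse (t k) *\<^sub>R G (xb + t k *\<^sub>R v k))) \<le> fst (inverse (t k) *\<^sub>R G (xb + t k *\<^sub>R v k))"
      using tv(1)[of k] by (simp add: mult_left_mono)
  qed
  then show ?thesis by (simp add: in_SOC_iff)
qed

text \<open>The scales \<open>t\<^sup>2\<close> and \<open>t\<^sup>3\<close> are chosen so that the curvature of the cone and of \<open>g\<close> enter only at
  order \<open>t\<^sup>4\<close>, below the displacement \<open>t\<^sup>3 u\<close>.\<close>

lemma feasible_curve:
  assumes q: "lin ub \<in> SOC" "fst (lin ub) > 0"
  obtains y K where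
    "\<forall>\<^sub>F t in at_right 0. y t \<in> feas \<and> norm (y t - (xb + t ^ 2 *\<^sub>R ub + t ^ 3 *\<^sub>R u))
        \<le> t ^ 3 * (\<sigma> * max 0 (lorentz (lin ub) (lin u) / fst (lin ub))) + K * t ^ 4"
proof -
  define q p where "q = lin ub" and "p = lin u"
  define z where "z t = xb + t ^ 2 *\<^sub>R ub + t ^ 3 *\<^sub>R u" for t
  define r where "r t = G (z t) - t ^ 2 *\<^sub>R (q + t *\<^sub>R p)" for t
  define m where "m = max 0 (lorentz q p / fst q)"
  define C where "C = (norm (snd p))\<^sup>2 / (2 * fst q)"
  have C: "C \<ge> 0" using q by (simp add: C_def q_def)
  have "vanish_order 2 (\<lambda>t. t ^ 2 *\<^sub>R ub + t ^ 3 *\<^sub>R u)" by (intro vanish_order_add vanish_order_power) auto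
  then have z2: "vanish_order 2 (\<lambda>t. z t - xb)" by (simp add: z_def)
  have xb2: "vanish_order 2 (\<lambda>t. xb - xb)" by (rule vanish_order_eventually_zero) simp
  \<comment> \<open>Both the distance to \<open>xb\<close> and the step are \<open>O(t ^ 2)\<close>,
    hence an error of order 4.\<close>
  have "vanish_order (Suc 1 + 2) (\<lambda>t. G (z t) - G xb - lin (z t - xb))"
    using z2 xb2 by (intro vanish_order_G_diff) (simp_all add: numeral_2_eq_2)
  moreover have "G (z t) - G xb - lin (z t - xb) = r t" for t
    by (simp add: G_xb r_def z_def lin.add lin.scaleR q_def p_def scaleR_add_right power3_eq_cube power2_eq_square)
  ultimately have "vanish_order 4 r" by (simp add: eval_nat_numeral)
  then obtain K where K: "K > 0" "\<forall>\<^sub>F t in at_right 0. norm (r t) \<le> K * t ^ 4" by (rule vanish_orderE)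
  obtain W where W: "open W" "xb \<in> W"
    "\<And>x. x \<in> W \<Longrightarrow> infdist x feas \<le> \<sigma> * infdist (G x) SOC"
    using MSCQ unfolding feas_def G_def by blast
  have "vanish_order (Suc 1) (\<lambda>t. z t - xb)" using z2 by (simp add: numeral_2_eq_2)
  then have "(z \<longlongrightarrow> xb) (at_right 0)" using vanish_order_tendsto_zero LIM_zero_iff by blast
  then have zW: "\<forall>\<^sub>F t in at_right 0. z t \<in> W" using W(1,2) by (rule topological_tendstoD)
  have "\<forall>\<^sub>F t in at_right 0. \<exists>y. y \<in> feas \<and> norm (y - z t) \<le> t ^ 3 * (\<sigma> * m) + (\<sigma> * (C + 2 * K) + 1) * t ^ 4"
    using K(2) zW eventually_pos_less[of 1, simplified]
  proof eventually_elim
    case (elim t)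
    have Gz: "G (z t) = t ^ 2 *\<^sub>R (q + t *\<^sub>R p) + r t" by (simp add: r_def)
    have "norm (snd (G (z t))) \<le> t ^ 2 * norm (snd q + t *\<^sub>R snd p) + norm (r t)"
      using norm_triangle_ineq[of "t ^ 2 *\<^sub>R (snd q + t *\<^sub>R snd p)" "snd (r t)"] norm_snd_le[of "snd (r t)" "fst (r t)"]
      by (simp add: Gz)
    moreover have "fst (G (z t)) \<ge> t ^ 2 * (fst q + t * fst p) - norm (r t)"
      using norm_fst_le[of "fst (r t)" "snd (r t)"] by (simp add: Gz distrib_left)
    ultimately have "norm (snd (G (z t))) - fst (G (z t))
        \<le> t ^ 2 * (norm (snd q + t *\<^sub>R snd p) - (fst q + t * fst p)) + 2 * norm (r t)"
      by (simp add: right_diff_distrib)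
    also have "\<dots> \<le> t ^ 2 * (t * m + t\<^sup>2 * C) + 2 * (K * t ^ 4)"
    proof (intro add_mono mult_left_mono)
      have "t * (lorentz q p / fst q) \<le> t * m" using elim by (intro mult_left_mono) (auto simp: m_def)
      then show "norm (snd q + t *\<^sub>R snd p) - (fst q + t * fst p) \<le> t * m + t\<^sup>2 * C"
        using SOC_gap_le[of q t p] q unfolding C_def q_def by linarith
    qed (use elim in auto)
    also have "\<dots> = t ^ 3 * m + (C + 2 * K) * t ^ 4" by (simp add: algebra_simps eval_nat_numeral)
    finally have "norm (snd (G (z t))) - fst (G (z t)) \<le> t ^ 3 * m + (C + 2 * K) * t ^ 4" .
    moreover have "0 \<le> t ^ 3 * m + (C + 2 * K) * t ^ 4" using elim C K by (simp add: m_def)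
    ultimately have "infdist (G (z t)) SOC \<le> t ^ 3 * m + (C + 2 * K) * t ^ 4"
      using infdist_SOC_le[of "G (z t)"] by linarith
    then have "\<sigma> * infdist (G (z t)) SOC \<le> \<sigma> * (t ^ 3 * m + (C + 2 * K) * t ^ 4)"
      using sigma by (intro mult_left_mono) auto
    then have "infdist (z t) feas \<le> \<sigma> * (t ^ 3 * m + (C + 2 * K) * t ^ 4)"
      using W(3)[of "z t"] elim by linarith
    \<comment> \<open>The extra \<open>t ^ 4\<close> makes the inequality strict, so a feasible
      point within the bound exists without attainment of the distance.\<close>
    also have "\<dots> < t ^ 3 * (\<sigma> * m) + (\<sigma> * (C + 2 * K) + 1) * t ^ 4"
      using elim by (simp add: algebra_simps)
    finally have "(INF a\<in>feas. dist (z t) a) < t ^ 3 * (\<sigma> * m) + (\<sigma> * (C + 2 * K) + 1) * t ^ 4"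
      using xb_feas by (subst (asm) infdist_notempty) auto
    then obtain y where "y \<in> feas" "dist (z t) y < t ^ 3 * (\<sigma> * m) + (\<sigma> * (C + 2 * K) + 1) * t ^ 4"
      using xb_feas by (subst (asm) cINF_less_iff) (auto intro!: bdd_belowI2[of _ 0])
    then show ?case by (intro exI[of _ y]) (auto simp: dist_norm norm_minus_commute)
  qed
  then obtain y where "\<forall>\<^sub>F t in at_right 0. y t \<in> feas \<and> norm (y t - z t) \<le> t ^ 3 * (\<sigma> * m) + (\<sigma> * (C + 2 * K) + 1) * t ^ 4"
    unfolding eventually_ex by blast
  then show ?thesis unfolding z_def m_def q_def p_def by (rule that)
qed

text \<open>Minimality along the curve of \<open>feasible_curve\<close>, divided by
  \<open>t ^ 3\<close>. Criticality removes the \<open>t ^ 2\<close> term, and the distance to the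
  feasible set, controlled through \<sigma>, enters as a penalty.\<close>

lemma first_order_bound:
  assumes min: "\<gamma> > 0" "\<And>y. y \<in> feas \<Longrightarrow> norm (y - xb) \<le> \<gamma> \<Longrightarrow> f xb \<le> f y"
    and q: "lin ub \<in> SOC" "fst (lin ub) > 0" and crit: "Df xb \<bullet> ub = 0"
  shows "Df xb \<bullet> u + norm (Df xb) * \<sigma> * max 0 (lorentz (lin ub) (lin u) / fst (lin ub)) \<ge> 0"
proof -
  define m where "m = \<sigma> * max 0 (lorentz (lin ub) (lin u) / fst (lin ub))"
  define z where "z t = xb + t ^ 2 *\<^sub>R ub + t ^ 3 *\<^sub>R u" for t
  obtain y K where y: "\<forall>\<^sub>F t in at_right 0. y t \<in> feas \<and> norm (y t - z t) \<le> t ^ 3 * m + K * t ^ 4"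
    unfolding z_def m_def by (rule feasible_curve[OF q])
  obtain L \<delta> where L: "L > 0" "\<delta> > 0"
    "\<And>x y. x \<in> ball xb \<delta> \<Longrightarrow> y \<in> ball xb \<delta> \<Longrightarrow>
      \<bar>f y - f x - Df xb \<bullet> (y - x)\<bar> \<le> L * norm (y - x) * (norm (x - xb) + norm (y - xb))"
    using C2_strict_differentiable[OF C2f xbU] by blast
  have "vanish_order 2 (\<lambda>t. t ^ 3 *\<^sub>R m + t ^ 4 *\<^sub>R K)" by (intro vanish_order_add vanish_order_power) auto
  then have "vanish_order 2 (\<lambda>t. y t - z t)"
  proof (rule vanish_order_bound)
    show "\<forall>\<^sub>F t in at_right 0. norm (y t - z t) \<le> norm (t ^ 3 *\<^sub>R m + t ^ 4 *\<^sub>R K)"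
      using y by eventually_elim (auto simp: mult.commute intro: order_trans[OF _ abs_ge_self])
  qed
  then have "vanish_order 2 (\<lambda>t. (y t - z t) + (t ^ 2 *\<^sub>R ub + t ^ 3 *\<^sub>R u))"
    by (intro vanish_order_add vanish_order_power) auto
  then have y2: "vanish_order 2 (\<lambda>t. y t - xb)" by (simp add: z_def algebra_simps)
  then obtain M where M: "M > 0" "\<forall>\<^sub>F t in at_right 0. norm (y t - xb) \<le> M * t ^ 2" by (rule vanish_orderE)
  have "vanish_order (Suc 1) (\<lambda>t. y t - xb)" using y2 by (simp add: numeral_2_eq_2)
  then have y0: "(y \<longlongrightarrow> xb) (at_right 0)" using vanish_order_tendsto_zero LIM_zero_iff by blast
  let ?B = "norm (Df xb) * K + L * M\<^sup>2"
  have "\<forall>\<^sub>F t in at_right 0. 0 \<le> Df xb \<bullet> u + norm (Df xb) * m + ?B * t"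
    using y M(2) tendstoD[OF y0 L(2)] tendstoD[OF y0 min(1)] eventually_pos_less[of 1, simplified]
  proof eventually_elim
    case (elim t)
    have "f xb \<le> f (y t)" using elim by (intro min) (auto simp: dist_norm)
    moreover have "\<bar>f (y t) - f xb - Df xb \<bullet> (y t - xb)\<bar> \<le> L * (norm (y t - xb) * norm (y t - xb))"
      using L(3)[of xb "y t"] L(2) elim by (simp add: dist_commute mult.assoc)
    moreover have "L * (norm (y t - xb) * norm (y t - xb)) \<le> L * ((M * t ^ 2) * (M * t ^ 2))"
      using elim L(1) M(1) by (intro mult_left_mono mult_mono) auto
    moreover have "Df xb \<bullet> (y t - xb) = t ^ 3 * (Df xb \<bullet> u) + Df xb \<bullet> (y t - z t)"
      by (simp add: z_def inner_diff_right inner_add_right crit)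
    moreover have "Df xb \<bullet> (y t - z t) \<le> norm (Df xb) * norm (y t - z t)" by (rule norm_cauchy_schwarz)
    moreover have "norm (Df xb) * norm (y t - z t) \<le> norm (Df xb) * (t ^ 3 * m + K * t ^ 4)"
      using elim by (intro mult_left_mono) auto
    ultimately have "0 \<le> t ^ 3 * (Df xb \<bullet> u) + norm (Df xb) * (t ^ 3 * m + K * t ^ 4) + L * ((M * t ^ 2) * (M * t ^ 2))"
      by linarith
    also have "\<dots> = t ^ 3 * (Df xb \<bullet> u + norm (Df xb) * m + ?B * t)"
      by (simp add: algebra_simps eval_nat_numeral)
    finally show ?case using elim by (simp add: zero_le_mult_iff)
  qed
  moreover have "((\<lambda>t. Df xb \<bullet> u + norm (Df xb) * m + ?B * t) \<longlongrightarrow> Df xb \<bullet> u + norm (Df xb) * m + ?B * 0) (at_right 0)"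
    by (intro tendsto_intros)
  ultimately have "0 \<le> Df xb \<bullet> u + norm (Df xb) * m + ?B * 0"
    using tendsto_lowerbound[OF _ _ trivial_limit_at_right_real] by blast
  then show ?thesis by (simp add: m_def mult.assoc)
qed

text \<open>With vanishing gradient the zero multiplier meets all multiplier conditions trivially.
  The quadratic form is even in \<open>u\<close>, so the sign of \<open>u\<close> may be chosen to
  make the penalty in \<open>feasible_curve\<close> vanish; the curves for the directions 0 and
  \<open>u\<close> then differ by \<open>t ^ 3 u + O(t ^ 4)\<close>.\<close>

lemma second_order_zero_gradient:
  assumes tilt: "tilt_stable f feas xb \<kappa>" and kappa: "\<kappa> > 0"
    and q: "lin ub \<in> SOC" "fst (lin ub) > 0" and D0: "Df xb = 0"
  shows "u \<bullet> (hess 0 0 *v u) \<ge> (norm u)\<^sup>2 / \<kappa>"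
proof -
  have *: "w \<bullet> (hess 0 0 *v w) \<ge> (norm w)\<^sup>2 / \<kappa>" if w: "lorentz (lin ub) (lin w) \<le> 0" for w
  proof -
    have curve: "\<exists>y. (\<forall>\<^sub>F t in at_right 0. y t \<in> feas) \<and> vanish_order 4 (\<lambda>t. y t - (xb + t ^ 2 *\<^sub>R ub + t ^ 3 *\<^sub>R d))"
      if "lorentz (lin ub) (lin d) \<le> 0" for d
    proof -
      have "max 0 (lorentz (lin ub) (lin d) / fst (lin ub)) = 0"
        using that q(2) by (simp add: divide_nonpos_pos)
      then obtain y K where y: "\<forall>\<^sub>F t in at_right 0. y t \<in> feas \<and> norm (y t - (xb + t ^ 2 *\<^sub>R ub + t ^ 3 *\<^sub>R d)) \<le> K * t ^ 4"
        using feasible_curve[OF q, of d] by auto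
      then show ?thesis by (intro exI[of _ y] conjI vanish_orderI[of _ K]) (auto elim: eventually_mono)
    qed
    obtain x where x: "\<forall>\<^sub>F t in at_right 0. x t \<in> feas" "vanish_order 4 (\<lambda>t. x t - (xb + t ^ 2 *\<^sub>R ub + t ^ 3 *\<^sub>R 0))"
      using curve[of 0] by (auto simp: lin.zero lorentz.zero_right)
    obtain y where y: "\<forall>\<^sub>F t in at_right 0. y t \<in> feas" "vanish_order 4 (\<lambda>t. y t - (xb + t ^ 2 *\<^sub>R ub + t ^ 3 *\<^sub>R w))"
      using curve[OF w] by blast
    have "vanish_order 1 (\<lambda>t. (x t - (xb + t ^ 2 *\<^sub>R ub + t ^ 3 *\<^sub>R 0)) + t ^ 2 *\<^sub>R ub)"
      by (intro vanish_order_add vanish_order_power vanish_order_mono[OF x(2)]) auto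
    then have x1: "vanish_order 1 (\<lambda>t. x t - xb)" by (simp add: algebra_simps)
    have yx: "vanish_order (Suc 3) (\<lambda>t. y t - x t - t ^ 3 *\<^sub>R w)"
      using vanish_order_diff[OF y(2) x(2)] by (simp add: algebra_simps)
    show ?thesis
      by (rule second_order_bound[OF tilt kappa x(1) y(1) x1 _ yx tendsto_const tendsto_const])
         (auto simp: D0 intro: vanish_order_eventually_zero)
  qed
  show ?thesis
  proof (cases "lorentz (lin ub) (lin u) \<le> 0")
    case False
    then have "lorentz (lin ub) (lin (- u)) \<le> 0" by (simp add: lin.neg lorentz.minus_right)
    from *[OF this] show ?thesis by (simp add: vec.neg)
  qed (rule *)
qed

section \<open>Curves on the boundary of the cone\<close>

lemma vanish_order_G_along:
  assumes "vanish_order 2 (\<lambda>t. z t - xb - t *\<^sub>R ub)"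
  shows "vanish_order 1 (\<lambda>t. z t - xb)" "vanish_order 2 (\<lambda>t. G (z t) - t *\<^sub>R lin ub)"
proof -
  have "vanish_order 1 (\<lambda>t. (z t - xb - t *\<^sub>R ub) + t ^ 1 *\<^sub>R ub)"
    by (intro vanish_order_add vanish_order_power vanish_order_mono[OF assms]) auto
  then show z1: "vanish_order 1 (\<lambda>t. z t - xb)" by simp
  have "vanish_order (Suc 0 + 1) (\<lambda>t. G (z t) - G xb - lin (z t - xb))"
    using z1 by (intro vanish_order_G_diff) (auto intro: vanish_order_eventually_zero)
  then have "vanish_order 2 (\<lambda>t. (G (z t) - G xb - lin (z t - xb)) + lin (z t - xb - t *\<^sub>R ub))"
    by (intro vanish_order_add vanish_order_linear[OF bounded_linear_lin] assms) (simp add: numeral_2_eq_2)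
  then show "vanish_order 2 (\<lambda>t. G (z t) - t *\<^sub>R lin ub)" by (simp add: G_xb lin.diff lin.scaleR)
qed

text \<open>Since \<open>G (z t)\<close> is close to \<open>t lin ub\<close>, moving
  \<open>z t\<close> by \<open>s C t ^ n d\<close> changes the Lorentz form by about
  \<open>2 s C a t ^ (n + 1)\<close> with \<open>a = lorentz (lin ub) (lin d) > 0\<close>. For
  suitable \<open>C\<close> this dominates the gap, with opposite signs at \<open>s = 1\<close> and
  \<open>s = -1\<close>, and the intermediate value theorem in \<open>s\<close> gives an exact
  zero.\<close>

lemma boundary_correction:
  assumes d: "lorentz (lin ub) (lin d) > 0" and z: "vanish_order 2 (\<lambda>t. z t - xb - t *\<^sub>R ub)" and n: "n \<ge> 2"
    and gap: "vanish_order (Suc n) (\<lambda>t. lorentz (G (z t)) (G (z t)))"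
  obtains \<tau> where "vanish_order n \<tau>"
    "\<forall>\<^sub>F t in at_right 0. lorentz (G (z t + \<tau> t *\<^sub>R d)) (G (z t + \<tau> t *\<^sub>R d)) = 0"
proof -
  define q where "q = lin ub"
  define a where "a = lorentz q (lin d)"
  have a: "a > 0" using d by (simp add: a_def q_def)
  obtain K where K: "K > 0" "\<forall>\<^sub>F t in at_right 0. norm (lorentz (G (z t)) (G (z t))) \<le> K * t ^ Suc n"
    using gap by (rule vanish_orderE)
  \<comment> \<open>With this \<open>C\<close> the change is \<open>2 s K t ^ (n + 1)\<close>: at
    \<open>s = 1\<close> and \<open>s = -1\<close> one half outweighs the gap and the other absorbs
    the \<open>O(t ^ (n + 2))\<close> error.\<close>
  define C where "C = K / a"
  have C: "C > 0" "C * a = K" using K a by (auto simp: C_def)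
  define y where "y s t = z t + (s * C * t ^ n) *\<^sub>R d" for s t
  define F where "F s t = lorentz (G (y s t)) (G (y s t))" for s t
  have yz: "vanish_order n (\<lambda>t. y s t - z t)" for s
    using vanish_order_power[of n n "(s * C) *\<^sub>R d"] by (simp add: y_def mult.commute)
  have y2: "vanish_order 2 (\<lambda>t. y s t - xb - t *\<^sub>R ub)" for s
    using vanish_order_add[OF z vanish_order_mono[OF yz n, of s]] by (simp add: algebra_simps)
  have E: "vanish_order (Suc (Suc n)) (\<lambda>t. F s t - lorentz (G (z t)) (G (z t)) - 2 * s * K * t ^ Suc n)" for s
  proof -
    define \<delta> where "\<delta> t = G (y s t) - G (z t)" for t
    have "vanish_order (Suc 0 + n) (\<lambda>t. G (y s t) - G (z t) - lin (y s t - z t))"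
      using vanish_order_G_along(1)[OF z] vanish_order_G_along(1)[OF y2[of s]] yz by (intro vanish_order_G_diff) auto
    then have d1: "vanish_order (Suc n) (\<lambda>t. \<delta> t - (s * C * t ^ n) *\<^sub>R lin d)"
      by (simp add: \<delta>_def y_def lin.scaleR)
    have "vanish_order n (\<lambda>t. (\<delta> t - (s * C * t ^ n) *\<^sub>R lin d) + t ^ n *\<^sub>R ((s * C) *\<^sub>R lin d))"
      by (intro vanish_order_add vanish_order_power vanish_order_mono[OF d1]) auto
    then have dn: "vanish_order n \<delta>" by (simp add: mult.commute)
    have e1: "vanish_order (Suc (Suc n)) (\<lambda>t. lorentz (G (z t) - t *\<^sub>R q) (\<delta> t))"
      using vanish_order_bilinear[OF bounded_bilinear_lorentz vanish_order_G_along(2)[OF z] dn] by (simp add: q_def)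
    have e2: "vanish_order (Suc (Suc n)) (\<lambda>t. t *\<^sub>R lorentz q (\<delta> t - (s * C * t ^ n) *\<^sub>R lin d))"
      by (intro vanish_order_scaleR_1 vanish_order_linear[OF lorentz.bounded_linear_right] d1)
    \<comment> \<open>Here \<open>n \<ge> 2\<close> enters: the quadratic term has order
      \<open>n + n \<ge> n + 2\<close>.\<close>
    have e3: "vanish_order (Suc (Suc n)) (\<lambda>t. lorentz (\<delta> t) (\<delta> t))"
      using n by (intro vanish_order_mono[OF vanish_order_bilinear[OF bounded_bilinear_lorentz dn dn]]) auto
    have "vanish_order (Suc (Suc n)) (\<lambda>t. (2 *\<^sub>R (lorentz (G (z t) - t *\<^sub>R q) (\<delta> t) + t *\<^sub>R lorentz q (\<delta> t - (s * C * t ^ n) *\<^sub>R lin d))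
        + lorentz (\<delta> t) (\<delta> t)))"
      by (intro vanish_order_add[OF vanish_order_linear[OF bounded_linear_scaleR_right] e3] vanish_order_add e1 e2)
    moreover have "F s t - lorentz (G (z t)) (G (z t)) - 2 * s * K * t ^ Suc n =
        2 *\<^sub>R (lorentz (G (z t) - t *\<^sub>R q) (\<delta> t) + t *\<^sub>R lorentz q (\<delta> t - (s * C * t ^ n) *\<^sub>R lin d)) + lorentz (\<delta> t) (\<delta> t)" for t
    proof -
      have "F s t = lorentz (G (z t) + \<delta> t) (G (z t) + \<delta> t)" by (simp add: F_def \<delta>_def)
      then have "F s t - lorentz (G (z t)) (G (z t)) = 2 * lorentz (G (z t)) (\<delta> t) + lorentz (\<delta> t) (\<delta> t)"
        by (simp add: lorentz_add_self)
      moreover have "t * lorentz q ((s * C * t ^ n) *\<^sub>R lin d) = s * K * t ^ Suc n"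
        by (simp add: lorentz.scaleR_right a_def[symmetric] C(2)[symmetric])
      moreover have "2 *\<^sub>R (lorentz (G (z t) - t *\<^sub>R q) (\<delta> t) + t *\<^sub>R lorentz q (\<delta> t - (s * C * t ^ n) *\<^sub>R lin d))
          = 2 * lorentz (G (z t)) (\<delta> t) - 2 * (t * lorentz q ((s * C * t ^ n) *\<^sub>R lin d))"
        unfolding real_scaleR_def by (simp only: lorentz.diff_left lorentz.diff_right lorentz.scaleR_left) (simp add: algebra_simps)
      ultimately show ?thesis by linarith
    qed
    ultimately show ?thesis by simp
  qed
  have small: "\<forall>\<^sub>F t in at_right 0. norm (F s t - lorentz (G (z t)) (G (z t)) - 2 * s * K * t ^ Suc n) < K * t ^ Suc n" for s
  proof -
    obtain M where M: "M > 0" "\<forall>\<^sub>F t in at_right 0. norm (F s t - lorentz (G (z t)) (G (z t)) - 2 * s * K * t ^ Suc n) \<le> M * t ^ Suc (Suc n)"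
      using E[of s] by (rule vanish_orderE)
    have "K / M > 0" using K M by simp
    from M(2) eventually_pos_less[OF this] show ?thesis
    proof eventually_elim
      case (elim t)
      have "M * t ^ Suc (Suc n) = (M * t) * t ^ Suc n" by simp
      also have "\<dots> < K * t ^ Suc n" using elim M(1) by (intro mult_strict_right_mono) (auto simp: field_simps)
      finally show ?case using elim by linarith
    qed
  qed
  obtain \<rho> where \<rho>: "\<rho> > 0" "ball xb \<rho> \<subseteq> U" using C2_onD(4)[OF C2f xbU] xbU open_contains_ball by blast
  have contG: "continuous_on (ball xb \<rho>) G"
  proof -
    have "continuous_on (ball xb \<rho>) g0"
      using C2_onD(1)[OF C2g0] \<rho>(2) by (intro has_derivative_continuous_on) (blast intro: has_derivative_at_withinI)
    moreover have "continuous_on (ball xb \<rho>) (\<lambda>x. gr x $ i)" for i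
      using C2_onD(1)[OF C2gr[rule_format]] \<rho>(2) by (intro has_derivative_continuous_on) (blast intro: has_derivative_at_withinI)
    then have "continuous_on (ball xb \<rho>) (\<lambda>x. \<chi> i. gr x $ i)" by (intro continuous_on_vec_lambda)
    ultimately show ?thesis unfolding G_def by (intro continuous_on_Pair) (simp_all add: vec_nth_inverse)
  qed
  have near: "\<forall>\<^sub>F t in at_right 0. y s t \<in> ball xb \<rho>" for s
  proof -
    have "vanish_order (Suc 0) (\<lambda>t. y s t - xb)" using vanish_order_G_along(1)[OF y2[of s]] by simp
    from tendstoD[OF vanish_order_tendsto_zero[OF this] \<rho>(1)] show ?thesis
      by eventually_elim (simp add: dist_norm norm_minus_commute)
  qed
  have "\<forall>\<^sub>F t in at_right 0. \<exists>\<tau>. \<bar>\<tau>\<bar> \<le> C * t ^ n \<and> lorentz (G (z t + \<tau> *\<^sub>R d)) (G (z t + \<tau> *\<^sub>R d)) = 0"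
    using K(2) small[of 1] small[of "-1"] near[of 1] near[of "-1"] eventually_pos_less[of 1, simplified]
  proof eventually_elim
    case (elim t)
    have ym: "y s t \<in> ball xb \<rho>" if "-1 \<le> s" "s \<le> 1" for s
    proof -
      \<comment> \<open>Writing \<open>y s t\<close> as a convex combination of its values at
        \<open>s = -1\<close> and \<open>s = 1\<close> keeps it in the ball on which
        \<open>G\<close> is continuous.\<close>
      have "s * C * t ^ n = (1 - (1 + s) / 2) * (- 1 * C * t ^ n) + (1 + s) / 2 * (1 * C * t ^ n)"
        by (simp add: field_simps)
      moreover have "(1 - k) *\<^sub>R (z t + b *\<^sub>R d) + k *\<^sub>R (z t + c *\<^sub>R d) = z t + ((1 - k) * b + k * c) *\<^sub>R d" for k b c
        by (simp add: algebra_simps)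
      ultimately have "y s t = (1 - (1 + s) / 2) *\<^sub>R y (-1) t + ((1 + s) / 2) *\<^sub>R y 1 t"
        unfolding y_def by (simp only:)
      then show ?thesis using convexD_alt[OF convex_ball elim(5,4), of "(1 + s) / 2"] that by simp
    qed
    have "continuous_on {-1..1} (\<lambda>s. G (y s t))"
      by (rule continuous_on_compose2[OF contG]) (auto simp: y_def intro!: continuous_intros ym[unfolded y_def])
    then have "continuous_on {-1..1} (\<lambda>s. F s t)"
      unfolding F_def by (intro lorentz.continuous_on)
    moreover have "F (-1) t \<le> 0" "0 \<le> F 1 t" using elim(1-3) unfolding real_norm_def by linarith+
    ultimately obtain s where s: "-1 \<le> s" "s \<le> 1" "F s t = 0"
      using IVT'[of "\<lambda>s. F s t" "-1" 0 1] by auto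
    show ?case
    proof (intro exI conjI)
      have "\<bar>s\<bar> * (C * t ^ n) \<le> 1 * (C * t ^ n)" using s C elim by (intro mult_right_mono) auto
      then show "\<bar>s * C * t ^ n\<bar> \<le> C * t ^ n" using C elim by (simp add: abs_mult mult.assoc)
      show "lorentz (G (z t + (s * C * t ^ n) *\<^sub>R d)) (G (z t + (s * C * t ^ n) *\<^sub>R d)) = 0"
        using s(3) by (simp add: F_def y_def)
    qed
  qed
  then obtain \<tau> where \<tau>: "\<forall>\<^sub>F t in at_right 0. \<bar>\<tau> t\<bar> \<le> C * t ^ n \<and> lorentz (G (z t + \<tau> t *\<^sub>R d)) (G (z t + \<tau> t *\<^sub>R d)) = 0"
    unfolding eventually_ex by blast
  show ?thesis
  proof (rule that[of \<tau>])
    show "vanish_order n \<tau>" by (rule vanish_orderI[of _ C]) (use \<tau> in \<open>auto elim: eventually_mono\<close>)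
    show "\<forall>\<^sub>F t in at_right 0. lorentz (G (z t + \<tau> t *\<^sub>R d)) (G (z t + \<tau> t *\<^sub>R d)) = 0"
      using \<tau> by eventually_elim simp
  qed
qed

text \<open>The multiplier at \<open>x t\<close> is \<open>\<alpha> / t\<close> times the reflection
  of \<open>G (x t)\<close>, so complementarity needs \<open>G (x t)\<close> to be exactly null, and
  the slack at \<open>y t\<close> must be \<open>O(t ^ 5)\<close>. Both curves come from
  \<open>boundary_correction\<close> in the direction \<open>d\<close>; the null conditions on
  \<open>lin ub\<close> and \<open>lin u\<close> provide the orders it requires.\<close>

lemma second_order_nonzero_multiplier:
  assumes tilt: "tilt_stable f feas xb \<kappa>" and kappa: "\<kappa> > 0" and \<alpha>: "\<alpha> > 0"
    and q: "lorentz (lin ub) (lin ub) = 0" "fst (lin ub) > 0"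
    and d: "lorentz (lin ub) (lin d) > 0"
    and stat: "Df xb + (\<alpha> * - fst (lin ub)) *\<^sub>R Dg0 xb + transpose (Dgr xb) *v (\<alpha> *\<^sub>R snd (lin ub)) = 0"
    and u: "lorentz (lin ub) (lin u) = 0" "lorentz (lin u) (lin u) = 0"
  shows "u \<bullet> (hess (\<alpha> * - fst (lin ub)) (\<alpha> *\<^sub>R snd (lin ub)) *v u) \<ge> (norm u)\<^sup>2 / \<kappa>"
proof -
  define q where "q = lin ub"
  define c where "c = fst (lin u) / fst q"
  have lu: "lin u = c *\<^sub>R q" unfolding c_def q_def by (rule lorentz_null_parallel[OF q(1) u q(2)])
  have z0: "vanish_order 2 (\<lambda>t. (xb + t *\<^sub>R ub) - xb - t *\<^sub>R ub)" by (rule vanish_order_eventually_zero) simp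
  have tq: "vanish_order 1 (\<lambda>t. t *\<^sub>R q)" using vanish_order_power[of 1 1 q] by simp
  \<comment> \<open>The \<open>t ^ 2\<close> coefficient \<open>lorentz q q\<close> vanishes, which
    leaves order 3, as \<open>boundary_correction\<close> with \<open>n = 2\<close>
    requires.\<close>
  have gap1: "vanish_order (Suc 2) (\<lambda>t. lorentz (G (xb + t *\<^sub>R ub)) (G (xb + t *\<^sub>R ub)))"
  proof -
    define r where "r t = G (xb + t *\<^sub>R ub) - t *\<^sub>R q" for t
    have r: "vanish_order 2 r" using vanish_order_G_along(2)[OF z0] unfolding r_def q_def .
    have "vanish_order (Suc 2) (\<lambda>t. 2 *\<^sub>R lorentz (t *\<^sub>R q) (r t) + lorentz (r t) (r t))"
      using vanish_order_bilinear[OF bounded_bilinear_lorentz tq r] vanish_order_bilinear[OF bounded_bilinear_lorentz r r]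
      by (intro vanish_order_add vanish_order_linear[OF bounded_linear_scaleR_right]) (auto intro: vanish_order_mono)
    moreover have "lorentz (G (xb + t *\<^sub>R ub)) (G (xb + t *\<^sub>R ub)) = 2 *\<^sub>R lorentz (t *\<^sub>R q) (r t) + lorentz (r t) (r t)" for t
      using lorentz_add_self[of "t *\<^sub>R q" "r t"] q(1)
      by (simp add: r_def lorentz.scaleR_left lorentz.scaleR_right q_def)
    ultimately show ?thesis by simp
  qed
  obtain \<tau>\<^sub>1 where t1: "vanish_order 2 \<tau>\<^sub>1"
    "\<forall>\<^sub>F t in at_right 0. lorentz (G (xb + t *\<^sub>R ub + \<tau>\<^sub>1 t *\<^sub>R d)) (G (xb + t *\<^sub>R ub + \<tau>\<^sub>1 t *\<^sub>R d)) = 0"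
    using boundary_correction[OF d z0 _ gap1] by blast
  define x where "x t = xb + t *\<^sub>R ub + \<tau>\<^sub>1 t *\<^sub>R d" for t
  have x0: "\<forall>\<^sub>F t in at_right 0. lorentz (G (x t)) (G (x t)) = 0" using t1(2) by (simp add: x_def)
  have x2: "vanish_order 2 (\<lambda>t. x t - xb - t *\<^sub>R ub)"
    using vanish_order_linear[OF bounded_linear_scaleR_left t1(1), of d] by (simp add: x_def)
  note Gx = vanish_order_G_along[OF x2, folded q_def]
  have z2: "vanish_order 2 (\<lambda>t. (x t + t ^ 2 *\<^sub>R u) - xb - t *\<^sub>R ub)"
    using vanish_order_add[OF x2 vanish_order_power[of 2 2 u]] by (simp add: algebra_simps)
  \<comment> \<open>Starting from a null \<open>G (x t)\<close>, the \<open>t ^ 3\<close>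
    coefficient is twice \<open>lorentz q (lin u) = 0\<close>, so the gap has order 4 and the second
    correction is only \<open>O(t ^ 3)\<close>, below the displacement
    \<open>t ^ 2 u\<close>.\<close>
  have gap2: "vanish_order (Suc 3) (\<lambda>t. lorentz (G (x t + t ^ 2 *\<^sub>R u)) (G (x t + t ^ 2 *\<^sub>R u)))"
  proof -
    define \<delta> where "\<delta> t = G (x t + t ^ 2 *\<^sub>R u) - G (x t)" for t
    have "vanish_order (Suc 0 + 2) (\<lambda>t. G (x t + t ^ 2 *\<^sub>R u) - G (x t) - lin ((x t + t ^ 2 *\<^sub>R u) - x t))"
      using Gx(1) vanish_order_G_along(1)[OF z2] by (intro vanish_order_G_diff) (auto intro: vanish_order_power)
    then have d3: "vanish_order 3 (\<lambda>t. \<delta> t - t ^ 2 *\<^sub>R lin u)"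
      by (simp add: \<delta>_def lin.scaleR eval_nat_numeral)
    have "vanish_order 2 (\<lambda>t. (\<delta> t - t ^ 2 *\<^sub>R lin u) + t ^ 2 *\<^sub>R lin u)"
      by (intro vanish_order_add vanish_order_power vanish_order_mono[OF d3]) auto
    then have d2: "vanish_order 2 \<delta>" by simp
    have "vanish_order 4 (\<lambda>t. (lorentz (G (x t) - t *\<^sub>R q) (\<delta> t) + lorentz (t *\<^sub>R q) (\<delta> t - t ^ 2 *\<^sub>R lin u)))"
      using vanish_order_bilinear[OF bounded_bilinear_lorentz Gx(2) d2] vanish_order_bilinear[OF bounded_bilinear_lorentz tq d3]
      by (intro vanish_order_add) auto
    moreover have "lorentz (t *\<^sub>R q) (t ^ 2 *\<^sub>R lin u) = 0" for t
      using u(1) by (simp add: lorentz.scaleR_left lorentz.scaleR_right q_def)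
    then have "lorentz (G (x t) - t *\<^sub>R q) (\<delta> t) + lorentz (t *\<^sub>R q) (\<delta> t - t ^ 2 *\<^sub>R lin u) = lorentz (G (x t)) (\<delta> t)" for t
      by (simp add: lorentz.diff_left lorentz.diff_right)
    ultimately have e1: "vanish_order 4 (\<lambda>t. lorentz (G (x t)) (\<delta> t))" by simp
    have "vanish_order 4 (\<lambda>t. lorentz (G (x t)) (G (x t)) + 2 *\<^sub>R lorentz (G (x t)) (\<delta> t) + lorentz (\<delta> t) (\<delta> t))"
      using vanish_order_bilinear[OF bounded_bilinear_lorentz d2 d2]
      by (intro vanish_order_add vanish_order_linear[OF bounded_linear_scaleR_right e1] vanish_order_eventually_zero[OF x0]) auto
    moreover have "lorentz (G (x t + t ^ 2 *\<^sub>R u)) (G (x t + t ^ 2 *\<^sub>R u))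
        = lorentz (G (x t)) (G (x t)) + 2 *\<^sub>R lorentz (G (x t)) (\<delta> t) + lorentz (\<delta> t) (\<delta> t)" for t
      using lorentz_add_self[of "G (x t)" "\<delta> t"] by (simp add: \<delta>_def)
    ultimately show ?thesis by (simp add: eval_nat_numeral)
  qed
  obtain \<tau>\<^sub>2 where t2: "vanish_order 3 \<tau>\<^sub>2"
    "\<forall>\<^sub>F t in at_right 0. lorentz (G (x t + t ^ 2 *\<^sub>R u + \<tau>\<^sub>2 t *\<^sub>R d)) (G (x t + t ^ 2 *\<^sub>R u + \<tau>\<^sub>2 t *\<^sub>R d)) = 0"
    using boundary_correction[OF d z2 _ gap2] by auto
  define y where "y t = x t + t ^ 2 *\<^sub>R u + \<tau>\<^sub>2 t *\<^sub>R d" for t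
  have y0: "\<forall>\<^sub>F t in at_right 0. lorentz (G (y t)) (G (y t)) = 0" using t2(2) by (simp add: y_def)
  have yx: "vanish_order 3 (\<lambda>t. y t - x t - t ^ 2 *\<^sub>R u)"
    using vanish_order_linear[OF bounded_linear_scaleR_left t2(1), of d] by (simp add: y_def)
  have "vanish_order 2 (\<lambda>t. (y t - x t - t ^ 2 *\<^sub>R u) + ((x t + t ^ 2 *\<^sub>R u) - xb - t *\<^sub>R ub))"
    by (intro vanish_order_add z2 vanish_order_mono[OF yx]) auto
  then have y2: "vanish_order 2 (\<lambda>t. y t - xb - t *\<^sub>R ub)" by (simp add: algebra_simps)
  note Gy = vanish_order_G_along[OF y2, folded q_def]
  have lim: "((\<lambda>t. inverse t *\<^sub>R G (w t)) \<longlongrightarrow> q) (at_right 0)" if "vanish_order 2 (\<lambda>t. G (w t) - t *\<^sub>R q)" for w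
    using vanish_order_tendsto_lim[of 1 "\<lambda>t. G (w t)" q] that by (simp add: numeral_2_eq_2)
  have feasible: "\<forall>\<^sub>F t in at_right 0. w t \<in> feas"
    if "vanish_order 2 (\<lambda>t. G (w t) - t *\<^sub>R q)" "\<forall>\<^sub>F t in at_right 0. lorentz (G (w t)) (G (w t)) = 0" for w
  proof -
    have "\<forall>\<^sub>F t in at_right 0. fst (inverse t *\<^sub>R G (w t)) > 0"
      using order_tendstoD(1)[OF tendsto_fst[OF lim[OF that(1)]]] q(2) by (simp add: q_def)
    then show ?thesis using that(2) eventually_pos_less[of 1, simplified]
    proof eventually_elim
      case (elim t)
      then have "fst (G (w t)) > 0" by (simp add: zero_less_mult_iff)
      then show ?case using elim by (simp add: feas_iff lorentz_self_zero_imp_SOC)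
    qed
  qed
  define l0 where "l0 t = \<alpha> * - fst (inverse t *\<^sub>R G (x t))" for t
  define lr where "lr t = \<alpha> *\<^sub>R snd (inverse t *\<^sub>R G (x t))" for t
  have pair: "l0 t * fst p + lr t \<bullet> snd p = \<alpha> / t * lorentz (G (x t)) p" for t p
    by (simp add: l0_def lr_def lorentz_def divide_inverse algebra_simps)
  \<comment> \<open>\<open>G y - G x\<close> agrees with a multiple of \<open>G x\<close> up to order 3; as both points lie on the boundary of the
    cone, the Lorentz form gains the square of that, which absorbs the factor \<open>\<alpha> / t\<close> of the multiplier.\<close>
  have cross: "vanish_order 6 (\<lambda>t. lorentz (G (x t)) (G (y t)))"
  proof -
    define r where "r t = G (y t) - G (x t) - (t * c) *\<^sub>R G (x t)" for t
    have "vanish_order 2 (\<lambda>t. (y t - x t - t ^ 2 *\<^sub>R u) + t ^ 2 *\<^sub>R u)"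
      by (intro vanish_order_add vanish_order_power vanish_order_mono[OF yx]) auto
    then have "vanish_order (Suc 0 + 2) (\<lambda>t. G (y t) - G (x t) - lin (y t - x t))"
      using Gx(1) Gy(1) by (intro vanish_order_G_diff) auto
    then have diff: "vanish_order 3 (\<lambda>t. G (y t) - G (x t) - lin (y t - x t))" by (simp add: eval_nat_numeral)
    have "vanish_order 3 (\<lambda>t. t *\<^sub>R (c *\<^sub>R (G (x t) - t *\<^sub>R q)))"
      using vanish_order_scaleR_1[OF vanish_order_linear[OF bounded_linear_scaleR_right Gx(2)], of c]
      by (simp add: eval_nat_numeral)
    from vanish_order_diff[OF vanish_order_add[OF diff vanish_order_linear[OF bounded_linear_lin yx]] this]
    have "vanish_order 3 (\<lambda>t. (G (y t) - G (x t) - lin (y t - x t)) + lin (y t - x t - t ^ 2 *\<^sub>R u)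
        - t *\<^sub>R (c *\<^sub>R (G (x t) - t *\<^sub>R q)))" .
    moreover have "(G (y t) - G (x t) - lin (y t - x t)) + lin (y t - x t - t ^ 2 *\<^sub>R u)
        - t *\<^sub>R (c *\<^sub>R (G (x t) - t *\<^sub>R q)) = r t" for t
      by (simp add: r_def lin.diff lin.scaleR lu scaleR_diff_right power2_eq_square mult.commute mult.left_commute)
    ultimately have r3: "vanish_order 3 r" by simp
    have "vanish_order 6 (\<lambda>t. lorentz (r t) (r t))"
      using vanish_order_bilinear[OF bounded_bilinear_lorentz r3 r3] by simp
    then show ?thesis
    proof (rule vanish_order_bound)
      have "((\<lambda>t. 1 + t * c) \<longlongrightarrow> 1 + 0 * c) (at_right 0)" by (intro tendsto_intros)
      then have "\<forall>\<^sub>F t in at_right 0. 1 + t * c > 1 / 2" by (rule order_tendstoD) simp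
      then show "\<forall>\<^sub>F t in at_right 0. norm (lorentz (G (x t)) (G (y t))) \<le> norm (lorentz (r t) (r t))"
        using x0 y0
      proof eventually_elim
        case (elim t)
        let ?x = "G (x t)" and ?y = "G (y t)"
        \<comment> \<open>\<open>r t\<close> equals \<open>G (y t) - (1 + t * c) G (x t)\<close>
          with both vectors null, so only the cross term survives; its factor exceeds 1 in absolute
          value.\<close>
        have "lorentz (r t) (r t) = - (2 * (1 + t * c)) * lorentz ?x ?y"
          unfolding r_def lorentz.diff_left lorentz.diff_right lorentz.scaleR_left lorentz.scaleR_right
            lorentz_commute[of ?y ?x] elim(2,3) by (simp add: algebra_simps)
        moreover have "\<bar>- (2 * (1 + t * c))\<bar> = 2 * (1 + t * c)"
          using elim(1) unfolding abs_minus_cancel by (intro abs_of_nonneg mult_nonneg_nonneg) linarith+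
        ultimately have "norm (lorentz (r t) (r t)) = (2 * (1 + t * c)) * \<bar>lorentz ?x ?y\<bar>"
          by (simp only: real_norm_def abs_mult)
        moreover have "1 * \<bar>lorentz ?x ?y\<bar> \<le> (2 * (1 + t * c)) * \<bar>lorentz ?x ?y\<bar>"
          using elim(1) by (intro mult_right_mono) auto
        ultimately show ?case by simp
      qed
    qed
  qed
  show ?thesis
  proof (rule second_order_bound[OF tilt kappa feasible[OF Gx(2) x0] feasible[OF Gy(2) y0] Gx(1),
        where n = 2 and ?l0.0 = l0 and lr = lr])
    show "vanish_order (Suc 2) (\<lambda>t. y t - x t - t ^ 2 *\<^sub>R u)" using yx by (simp add: eval_nat_numeral)
    show "(l0 \<longlongrightarrow> \<alpha> * - fst (lin ub)) (at_right 0)" "(lr \<longlongrightarrow> \<alpha> *\<^sub>R snd (lin ub)) (at_right 0)"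
      unfolding l0_def lr_def by (intro tendsto_intros lim[OF Gx(2), unfolded q_def])+
    show "\<forall>\<^sub>F t in at_right 0. \<forall>p\<in>SOC. l0 t * fst p + lr t \<bullet> snd p \<le> 0"
      using feasible[OF Gx(2) x0] eventually_pos_less[of 1, simplified]
    proof eventually_elim
      case (elim t)
      show ?case unfolding pair
        by (intro ballI mult_nonneg_nonpos lorentz_SOC_nonpos) (use elim \<alpha> in \<open>auto simp: feas_iff\<close>)
    qed
    show "\<forall>\<^sub>F t in at_right 0. l0 t * g0 (x t) + lr t \<bullet> gr (x t) = 0"
      using x0
    proof eventually_elim
      case (elim t)
      then show ?case using pair[of t "G (x t)"] by (simp add: G_def)
    qed
    \<comment> \<open>Division by \<open>t\<close> lowers the order from 6 to 5, exactly the order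
      demanded for \<open>n = 2\<close>.\<close>
    have "vanish_order (Suc (2 * 2)) (\<lambda>t. \<alpha> / t * lorentz (G (x t)) (G (y t)))"
      using cross by (intro vanish_order_divide) simp
    moreover have "\<alpha> / t * lorentz (G (x t)) (G (y t)) = l0 t * g0 (y t) + lr t \<bullet> gr (y t)" for t
      using pair[of t "G (y t)"] by (simp add: G_def)
    ultimately show "vanish_order (Suc (2 * 2)) (\<lambda>t. l0 t * g0 (y t) + lr t \<bullet> gr (y t))" by simp
  qed (use stat in auto)
qed

text \<open>\<open>e\<close> represents the linear form \<open>lorentz (lin ub) (lin w)\<close> in
  \<open>w\<close>. The first-order bound and \<open>one_sided_farkas\<close> give
  \<open>Df xb = - \<alpha> e\<close> with \<open>\<alpha> = norm (Df xb) / norm e\<close>, so the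
  special multiplier is \<alpha> times the reflection of \<open>lin ub\<close>, and the two
  preceding cases apply.\<close>

lemma second_order_special_multiplier:
  fixes ub
  defines "e \<equiv> - (Dg0 xb \<bullet> ub) *\<^sub>R Dg0 xb + transpose (Dgr xb) *v (Dgr xb *v ub)"
  defines "lam0 \<equiv> (norm (Df xb) / norm e) * (- (Dg0 xb \<bullet> ub))"
    and "lamr \<equiv> (norm (Df xb) / norm e) *\<^sub>R (Dgr xb *v ub)"
  assumes tilt: "tilt_stable f feas xb \<kappa>" and kappa: "\<kappa> > 0"
    and ub: "ub \<in> critical_cone feas xb (- Df xb)"
    and ub_nz: "(Dg0 xb \<bullet> ub, Dgr xb *v ub) \<noteq> (0, 0)"
    and u: "norm u = 1" "lam0 * (Dg0 xb \<bullet> u) + lamr \<bullet> (Dgr xb *v u) = 0"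
      "lam0 * ((norm (Dgr xb *v u))\<^sup>2 - (Dg0 xb \<bullet> u)\<^sup>2) = 0"
  shows "u \<bullet> (hess lam0 lamr *v u) \<ge> 1 / \<kappa>"
proof -
  define \<alpha> where "\<alpha> = norm (Df xb) / norm e"
  have q: "lin ub \<in> SOC" using tangent_imp_lin_SOC ub by (auto simp: critical_cone_def)
  have q0: "fst (lin ub) > 0"
  proof (rule ccontr)
    assume "\<not> fst (lin ub) > 0"
    moreover have "norm (snd (lin ub)) \<le> fst (lin ub)" using q by (simp add: in_SOC_iff)
    ultimately have "fst (lin ub) = 0" "norm (snd (lin ub)) = 0"
      using norm_ge_zero[of "snd (lin ub)"] by linarith+
    then show False using ub_nz by (simp add: lin_def)
  qed
  have crit: "Df xb \<bullet> ub = 0" using ub by (simp add: critical_cone_def)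
  have e: "lorentz (lin ub) (lin w) = e \<bullet> w" for w
    by (simp add: lorentz_def lin_def e_def inner_add_left inner_diff_left dot_lmul_matrix)
  obtain \<gamma> where \<gamma>: "\<gamma> > 0" "tilt_argmin f feas xb \<gamma> 0 = {xb}"
    using tilt unfolding tilt_stable_def by blast
  have "xb \<in> tilt_argmin f feas xb \<gamma> 0" by (simp add: \<gamma>(2))
  then have min: "f xb \<le> f y" if "y \<in> feas" "norm (y - xb) \<le> \<gamma>" for y
    using that by (auto simp: tilt_argmin_def dist_norm norm_minus_commute)
  have Df: "Df xb = - \<alpha> *\<^sub>R e" unfolding \<alpha>_def
  proof (rule one_sided_farkas[where C = "norm (Df xb) * \<sigma> / fst (lin ub)"])
    fix w
    have "max 0 (lorentz (lin ub) (lin w) / fst (lin ub)) = max 0 (e \<bullet> w) / fst (lin ub)"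
      using q0 by (simp add: e max_def divide_le_0_iff zero_le_divide_iff)
    then show "Df xb \<bullet> w + norm (Df xb) * \<sigma> / fst (lin ub) * max 0 (e \<bullet> w) \<ge> 0"
      using first_order_bound[OF \<gamma>(1) min q q0 crit, of w] by simp
  qed
  have lam: "lam0 = \<alpha> * - fst (lin ub)" "lamr = \<alpha> *\<^sub>R snd (lin ub)"
    by (simp_all add: lam0_def lamr_def \<alpha>_def lin_def)
  show ?thesis
  proof (cases "\<alpha> = 0")
    \<comment> \<open>This covers \<open>e = 0\<close> too, where the quotient is 0 by convention;
      \<open>Df xb = - \<alpha> e\<close> vanishes either way.\<close>
    case True
    then show ?thesis using second_order_zero_gradient[OF tilt kappa q q0, of u] Df u(1) by (simp add: lam)
  next
    case False
    then have \<alpha>: "\<alpha> > 0" by (simp add: \<alpha>_def less_le)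
    have "e \<noteq> 0" using False by (auto simp: \<alpha>_def)
    \<comment> \<open>Criticality of \<open>ub\<close> and \<open>Df xb = - \<alpha> e\<close> force
      \<open>e \<bullet> ub = 0\<close>, so \<open>lin ub\<close> is null; \<open>e\<close> itself
      then serves as the direction \<open>d\<close>, as \<open>e \<bullet> e > 0\<close>.\<close>
    have "lorentz (lin ub) (lin ub) = 0" using crit False by (simp add: e Df)
    moreover have "lorentz (lin ub) (lin e) > 0" using \<open>e \<noteq> 0\<close> by (simp add: e)
    moreover have "Df xb + (\<alpha> * - fst (lin ub)) *\<^sub>R Dg0 xb + transpose (Dgr xb) *v (\<alpha> *\<^sub>R snd (lin ub)) = 0"
    proof -
      have "transpose (Dgr xb) *v (\<alpha> *\<^sub>R snd (lin ub)) = \<alpha> *\<^sub>R (transpose (Dgr xb) *v snd (lin ub))"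
        by (rule matrix_vector_mult_scaleR)
      then show ?thesis unfolding Df e_def by (simp add: lin_def algebra_simps)
    qed
    moreover have "lorentz (lin ub) (lin u) = 0"
    proof -
      have "\<alpha> * lorentz (lin ub) (lin u) = lam0 * (Dg0 xb \<bullet> u) + lamr \<bullet> (Dgr xb *v u)"
        by (simp add: lam lorentz_def lin_def algebra_simps)
      then show ?thesis using u(2) False by simp
    qed
    moreover have "lorentz (lin u) (lin u) = 0"
      using u(3) False q0 by (simp add: lam lorentz_def lin_def dot_square_norm power2_eq_square)
    ultimately have "u \<bullet> (hess (\<alpha> * - fst (lin ub)) (\<alpha> *\<^sub>R snd (lin ub)) *v u) \<ge> (norm u)\<^sup>2 / \<kappa>"
      by (intro second_order_nonzero_multiplier[OF tilt kappa \<alpha>]) (use q0 in auto)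
    then show ?thesis by (simp add: lam u(1))
  qed
qed

end

theorem theorem5p1:
  fixes f :: "real^'n \<Rightarrow> real" and Df :: "real^'n \<Rightarrow> real^'n" and Hf :: "real^'n \<Rightarrow> real^'n^'n"
    and g0 :: "real^'n \<Rightarrow> real" and Dg0 :: "real^'n \<Rightarrow> real^'n" and Hg0 :: "real^'n \<Rightarrow> real^'n^'n"
    and gr :: "real^'n \<Rightarrow> real^'m" and Dgr :: "real^'n \<Rightarrow> real^'n^'m"
    and Hgr :: "real^'n \<Rightarrow> 'm \<Rightarrow> real^'n^'n"
    and xb ub :: "real^'n" and \<sigma> \<kappa> :: real and U :: "(real^'n) set"
  defines "\<Gamma> \<equiv> {x. (g0 x, gr x) \<in> SOC}"
  defines "lam0 \<equiv> (norm (Df xb) / norm (- (Dg0 xb \<bullet> ub) *\<^sub>R Dg0 xb + transpose (Dgr xb) *v (Dgr xb *v ub)))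
                 * (- (Dg0 xb \<bullet> ub))"
  defines "lamr \<equiv> (norm (Df xb) / norm (- (Dg0 xb \<bullet> ub) *\<^sub>R Dg0 xb + transpose (Dgr xb) *v (Dgr xb *v ub)))
                 *\<^sub>R (Dgr xb *v ub)"
  defines "H \<equiv> Hf xb + lam0 *\<^sub>R Hg0 xb + (\<Sum>i\<in>UNIV. (lamr $ i) *\<^sub>R Hgr xb i)"
  defines "crit \<equiv> {u. norm u = 1 \<and> lam0 * (Dg0 xb \<bullet> u) + lamr \<bullet> (Dgr xb *v u) = 0 \<and>
                    lam0 * ((norm (Dgr xb *v u))\<^sup>2 - (Dg0 xb \<bullet> u)\<^sup>2) = 0}"
  assumes U: "open U" "xb \<in> U"
    and C2f: "C2_on f Df Hf U"
    and C2g0: "C2_on g0 Dg0 Hg0 U"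
    and C2gr: "\<forall>i. C2_on (\<lambda>x. gr x $ i) (\<lambda>x. Dgr x $ i) (\<lambda>x. Hgr x i) U"
    and gxb: "g0 xb = 0" "gr xb = 0"
    and stat: "- Df xb \<in> limiting_normal_cone \<Gamma> xb"
    and sigma: "\<sigma> > 0"
    and MSCQ: "\<exists>W. open W \<and> xb \<in> W \<and>
                 (\<forall>x\<in>W. infdist x \<Gamma> \<le> \<sigma> * infdist (g0 x, gr x) SOC)"
    and kappa: "\<kappa> > 0"
    and tilt: "tilt_stable f \<Gamma> xb \<kappa>"
    and ub: "ub \<in> critical_cone \<Gamma> xb (- Df xb)"
    and ub_nz: "(Dg0 xb \<bullet> ub, Dgr xb *v ub) \<noteq> (0, 0)"
  shows "(\<forall>u\<in>crit. u \<bullet> (H *v u) \<ge> 1 / \<kappa>) \<and>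
         tilt_bound f \<Gamma> xb \<ge> (SUP u\<in>crit. ereal (1 / (u \<bullet> (H *v u))))"
proof -
  interpret soc_program f Df Hf g0 Dg0 Hg0 gr Dgr Hgr xb \<sigma> U
    using assms by unfold_locales auto
  have feas: "feas = \<Gamma>" by (simp add: feas_def \<Gamma>_def)
  have H: "hess lam0 lamr = H" by (simp add: hess_def H_def)
  \<comment> \<open>Stated for every modulus \<open>K\<close>, since estimating the exact bound
    needs moduli other than \<kappa>.\<close>
  have bound: "u \<bullet> (H *v u) \<ge> 1 / K" if "tilt_stable f \<Gamma> xb K" "K > 0" "u \<in> crit" for K u
    using second_order_special_multiplier[of K ub u] that ub ub_nz
    unfolding feas lam0_def[symmetric] lamr_def[symmetric] H crit_def by blast
  show ?thesis
  proof (intro conjI ballI)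
    show "u \<bullet> (H *v u) \<ge> 1 / \<kappa>" if "u \<in> crit" for u
      by (rule bound[OF tilt kappa that])
    show "tilt_bound f \<Gamma> xb \<ge> (SUP u\<in>crit. ereal (1 / (u \<bullet> (H *v u))))"
    proof (rule SUP_least)
      fix u assume u: "u \<in> crit"
      show "ereal (1 / (u \<bullet> (H *v u))) \<le> tilt_bound f \<Gamma> xb"
        unfolding tilt_bound_def lip_at0_def
      proof (rule INF_greatest, rule Inf_greatest, clarify)
        fix \<gamma> L d :: real
        assume \<gamma>: "\<gamma> > 0" "tilt_argmin f \<Gamma> xb \<gamma> 0 = {xb}" and L: "L \<ge> 0" and d: "d > 0"
          and single: "\<forall>v\<in>ball 0 d. \<exists>x. tilt_argmin f \<Gamma> xb \<gamma> v = {x}"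
          and lip: "\<forall>v\<in>ball 0 d. \<forall>w\<in>ball 0 d. \<forall>x\<in>tilt_argmin f \<Gamma> xb \<gamma> v.
            \<forall>y\<in>tilt_argmin f \<Gamma> xb \<gamma> w. dist x y \<le> L * dist v w"
        \<comment> \<open>A competing constant \<open>L\<close> may be 0, whereas a modulus must be
          positive; hence the passage through all \<open>K > L\<close> and a density
          argument.\<close>
        have "1 / (u \<bullet> (H *v u)) \<le> K" if K: "L < K" for K
        proof -
          have "tilt_stable f \<Gamma> xb K"
            unfolding tilt_stable_def
          proof (rule exI[of _ \<gamma>], intro conjI exI[of _ "ball 0 d"] ballI)
            fix v w x y assume vw: "v \<in> ball 0 d" "w \<in> ball 0 d"
              "x \<in> tilt_argmin f \<Gamma> xb \<gamma> v" "y \<in> tilt_argmin f \<Gamma> xb \<gamma> w"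
            have "dist x y \<le> L * dist v w" using lip vw by blast
            also have "\<dots> \<le> K * dist v w" using K by (intro mult_right_mono) auto
            finally show "dist x y \<le> K * dist v w" .
          qed (use \<gamma> d single in auto)
          from bound[OF this _ u] have "1 / K \<le> u \<bullet> (H *v u)" "K > 0" using K L by auto
          moreover from this have "u \<bullet> (H *v u) > 0" by (meson divide_pos_pos less_le_trans zero_less_one)
          ultimately show ?thesis by (simp add: field_simps)
        qed
        then show "ereal (1 / (u \<bullet> (H *v u))) \<le> ereal L"
          by (simp add: dense_ge)
      qed
    qed
  qed
qed

end
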